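(* Let $k\ge 1$ be an integer, let $\mathbf Z$ be a standard normal random vector in $\mathbb R^k$, and suppose that a function $f\colon\mathbb R^k\to[0,\infty]$ is Schur$^2$-concave. Take any $\sigma\in(0,\infty)$, and let $f^{(\sigma)}(\mathbf x):=\mathsf E f(\sigma\mathbf Z+\mathbf x)$ for $\mathbf x\in\mathbb R^k$. (I) Then the function $\mathbb R^k\ni\mathbf x\mapsto f^{(\sigma)}(\mathbf x)$ is Schur$^2$-concave as well. (II) Moreover, $f^{(\sigma)}$ is strictly Schur$^2$-concave unless $f$ is equivalent to a spherically symmetric function (in which latter case $f^{(\sigma)}$ is spherically symmetric, too).
   Context: Standard normal in $\mathbb R^k$: zero mean and identity covariance matrix. Majorization: for $\mathbf a,\mathbf b\in\mathbb R^k$, $\mathbf a\succeq\mathbf b$ (equivalently $\mathbf b\preceq\mathbf a$) means $a_1+\dots+a_k=b_1+\dots+b_k$ and $a_{[1]}+\dots+a_{[j]}\ge b_{[1]}+\dots+b_{[j]}$ for all $j\in\{1,\dots,k\}$, where $a_{[1]}\ge\dots\ge a_{[k]}$ are the numbers $a_1,\dots,a_k$ in nonincreasing order. Let $\mathbf a_\downarrow:=(a_{[1]},\dots,a_{[k]})$. Write $\mathbf a\succ\mathbf b$ if $\mathbf a\succeq\mathbf b$ and $\mathbf a_\downarrow\ne\mathbf b_\downarrow$. For $E\subseteq\mathbb R^k$, a function $g\colon E\to[0,\infty]$ is Schur-concave if $g(\mathbf a)\le g(\mathbf b)$ whenever $\mathbf a,\mathbf b\in E$ and $\mathbf a\succeq\mathbf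 b$. It is strictly Schur-concave if for all $\mathbf a,\mathbf b\in E$ with $\mathbf a\succ\mathbf b$ one has $g(\mathbf a)<g(\mathbf b)$ or $g(\mathbf a)=g(\mathbf b)=\infty$. A Lebesgue-measurable function $f\colon\mathbb R^k\to[0,\infty]$ is (strictly) Schur$^2$-concave if there is a (strictly) Schur-concave function $g\colon[0,\infty)^k\to[0,\infty]$ with $f(x_1,\dots,x_k)=g(x_1^2,\dots,x_k^2)$ for all $(x_1,\dots,x_k)\in\mathbb R^k$. A measurable function on $\mathbb R^k$ is spherically symmetric if it is constant on each Euclidean sphere $\{\mathbf x\in\mathbb R^k\colon\|\mathbf x\|=r\}$, $r\in(0,\infty)$. Two Lebesgue-measurable functions on $\mathbb R^k$ are equivalent if they are equal almost everywhere with respect to Lebesgue measure. *)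

theory Defs
  imports "HOL-Probability.Probability"
begin

subsection \<open>Majorization and Schur-concavity\<close>

text \<open>The coordinates \<open>a\<^sub>1, \<dots>, a\<^sub>k\<close>, with multiplicities, in nonincreasing order
  (the vector written \<open>a\<close> with a down arrow).\<close>

definition decreasing_rearr :: "real ^ 'n::finite \<Rightarrow> real list" where
  "decreasing_rearr a = rev (sorted_list_of_multiset (image_mset (\<lambda>i. a $ i) (mset_set UNIV)))"

definition majorizes :: "real ^ 'n::finite \<Rightarrow> real ^ 'n \<Rightarrow> bool" where
  "majorizes a b \<longleftrightarrow>
     (\<Sum>i\<in>UNIV. a $ i) = (\<Sum>i\<in>UNIV. b $ i) \<and>
     (\<forall>j\<in>{1..CARD('n)}.
        sum_list (take j (decreasing_rearr a)) \<ge> sum_list (take j (decreasing_rearr b)))"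

definition strictly_majorizes :: "real ^ 'n::finite \<Rightarrow> real ^ 'n \<Rightarrow> bool" where
  "strictly_majorizes a b \<longleftrightarrow> majorizes a b \<and> decreasing_rearr a \<noteq> decreasing_rearr b"

definition schur_concave_on :: "(real ^ 'n::finite) set \<Rightarrow> (real ^ 'n \<Rightarrow> ennreal) \<Rightarrow> bool" where
  "schur_concave_on E g \<longleftrightarrow> (\<forall>a\<in>E. \<forall>b\<in>E. majorizes a b \<longrightarrow> g a \<le> g b)"

definition strictly_schur_concave_on ::
    "(real ^ 'n::finite) set \<Rightarrow> (real ^ 'n \<Rightarrow> ennreal) \<Rightarrow> bool" where
  "strictly_schur_concave_on E g \<longleftrightarrow>
     (\<forall>a\<in>E. \<forall>b\<in>E. strictly_majorizes a b \<longrightarrow> g a < g b \<or> (g a = \<infinity> \<and> g b = \<infinity>))"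

definition nonneg_orthant :: "(real ^ 'n::finite) set" where
  "nonneg_orthant = {a. \<forall>i. 0 \<le> a $ i}"

text \<open>A function on \<open>nonneg_orthant\<close> is represented by a total one; its values off the orthant
  play no role below.\<close>

definition schur2_concave :: "(real ^ 'n::finite \<Rightarrow> ennreal) \<Rightarrow> bool" where
  "schur2_concave f \<longleftrightarrow>
     f \<in> borel_measurable lebesgue \<and>
     (\<exists>g. schur_concave_on nonneg_orthant g \<and> (\<forall>x. f x = g (\<chi> i. (x $ i)\<^sup>2)))"

definition strictly_schur2_concave :: "(real ^ 'n::finite \<Rightarrow> ennreal) \<Rightarrow> bool" where
  "strictly_schur2_concave f \<longleftrightarrow>
     f \<in> borel_measurable lebesgue \<and>
     (\<exists>g. strictly_schur_concave_on nonneg_orthant g \<and> (\<forall>x. f x = g (\<chi> i. (x $ i)\<^sup>2)))"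


subsection \<open>Spherical symmetry and equivalence\<close>

definition spherically_symmetric :: "(real ^ 'n::finite \<Rightarrow> ennreal) \<Rightarrow> bool" where
  "spherically_symmetric f \<longleftrightarrow>
     f \<in> borel_measurable lebesgue \<and> (\<forall>r>0. f constant_on sphere 0 r)"

definition lebesgue_equivalent ::
    "(real ^ 'n::finite \<Rightarrow> ennreal) \<Rightarrow> (real ^ 'n \<Rightarrow> ennreal) \<Rightarrow> bool" where
  "lebesgue_equivalent f h \<longleftrightarrow>
     f \<in> borel_measurable lebesgue \<and> h \<in> borel_measurable lebesgue \<and>
     (AE x in lebesgue. f x = h x)"


subsection \<open>Standard normal vectors and Gaussian smoothing\<close>

text \<open>The density of the nondegenerate normal distribution with mean \<open>\<mu>\<close> and (positive definite)
  covariance matrix \<open>\<Sigma>\<close>.\<close>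

definition multivariate_normal_density ::
    "real ^ 'n::finite \<Rightarrow> real ^ 'n ^ 'n \<Rightarrow> real ^ 'n \<Rightarrow> real" where
  "multivariate_normal_density \<mu> \<Sigma> z =
     1 / sqrt ((2 * pi) ^ CARD('n) * det \<Sigma>)
       * exp (- ((z - \<mu>) \<bullet> (matrix_inv \<Sigma> *v (z - \<mu>))) / 2)"

definition standard_normal_vector :: "'w measure \<Rightarrow> ('w \<Rightarrow> real ^ 'n::finite) \<Rightarrow> bool" where
  "standard_normal_vector M Z \<longleftrightarrow>
     distributed M lborel Z (\<lambda>z. ennreal (multivariate_normal_density 0 (mat 1) z))"

lemma multivariate_normal_density_standard:
  "multivariate_normal_density 0 (mat 1) (z :: real ^ 'n::finite) =
     (\<Prod>i\<in>UNIV. std_normal_density (z $ i))"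
proof -
  have "\<exists>B. (mat 1 :: real ^ 'n ^ 'n) ** B = mat 1 \<and> B ** (mat 1 :: real ^ 'n ^ 'n) = mat 1"
    by (rule exI[of _ "mat 1"]) simp
  from someI_ex[OF this] have inv: "matrix_inv (mat 1 :: real ^ 'n ^ 'n) = mat 1"
    unfolding matrix_inv_def by simp
  have "z \<bullet> z = (\<Sum>i\<in>UNIV. (z $ i)\<^sup>2)"
    by (simp add: inner_vec_def power2_eq_square)
  then have "- (z \<bullet> z) / 2 = (\<Sum>i\<in>UNIV. - (z $ i)\<^sup>2 / 2)"
    by (simp add: sum_negf sum_divide_distrib)
  then have "exp (- (z \<bullet> z) / 2) = (\<Prod>i\<in>UNIV. exp (- (z $ i)\<^sup>2 / 2))"
    by (simp only: exp_sum[OF finite])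
  then show ?thesis
    by (simp add: multivariate_normal_density_def inv std_normal_density_def prod.distrib
        prod_dividef power_divide flip: real_sqrt_power)
qed

text \<open>\<open>f\<^sup>\<sigma>(x) = E f(\<sigma>Z + x)\<close>. For Lebesgue measurable \<open>f\<close> the integrand need only be measurable with
  respect to the completion of \<open>M\<close>; the integral is nevertheless the right one, since
  \<open>nn_integral (completion M) = nn_integral M\<close> for all integrands
  (\<open>nn_integral_completion\<close>).\<close>

definition gaussian_smoothing ::
    "'w measure \<Rightarrow> ('w \<Rightarrow> real ^ 'n::finite) \<Rightarrow> real \<Rightarrow> (real ^ 'n \<Rightarrow> ennreal) \<Rightarrow> real ^ 'n \<Rightarrow> ennreal"
  where "gaussian_smoothing M Z \<sigma> f x = (\<integral>\<^sup>+ \<omega>. f (\<sigma> *\<^sub>R Z \<omega> + x) \<partial>M)"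

end

theory Submission
  imports Defs
begin

text \<open>
  By the Hardy--Littlewood--Polya characterization of majorization, it is enough to treat a transfer
  that changes only two coordinates of the vector of squares, i.e. to compare the smoothing at two
  points \<open>x\<close>, \<open>x'\<close> of a circle in a coordinate plane. The reflection \<open>R\<close> swapping \<open>x\<close> and \<open>x'\<close> need not
  preserve \<open>f\<close>, but the rotations by multiples of the right angle in that plane do. Averaging the
  Gaussian kernels over the orbits of \<open>x'\<close> and of \<open>x\<close> under these rotations gives weights \<open>K\<^sub>1\<close> and \<open>K\<^sub>2 = K\<^sub>1 \<circ> R\<close>
  for which \<open>K\<^sub>1 - K\<^sub>2\<close> and \<open>f - f \<circ> R\<close> have the same sign everywhere; integrating
  \<open>(f - f \<circ> R) (K\<^sub>1 - K\<^sub>2) \<ge> 0\<close> is the asserted inequality.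

  If equality holds with a finite value, then \<open>f = f \<circ> R\<close> almost everywhere; by monotonicity equality
  also holds on the whole arc between \<open>x\<close> and \<open>x'\<close>, so \<open>f\<close> is invariant under an open set of
  reflections of the plane, hence under all of them and, by permutation symmetry, under every
  reflection of the space. Fubini's theorem then shows that \<open>f\<close> agrees almost everywhere with its mean
  over directions.
\<close>


subsection \<open>Orthogonal invariance of Lebesgue measure\<close>

text \<open>The change of variables theorems of HOL-Analysis require a well-ordered index type; a finite index
  type is replaced by a copy of an initial segment of the naturals.\<close>

typedef (overloaded) 'a idx = "{..<CARD('a::finite)}"
  by (rule exI[of _ 0]) (simp add: card_gt_0_iff)

setup_lifting type_definition_idx

instantiation idx :: (finite) wellorder
begin

lift_definition less_eq_idx :: "'a idx \<Rightarrow> 'a idx \<Rightarrow> bool" is "(\<le>)" .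

lift_definition less_idx :: "'a idx \<Rightarrow> 'a idx \<Rightarrow> bool" is "(<)" .

instance
proof
  fix P :: "'a idx \<Rightarrow> bool" and a
  assume step: "\<And>x. (\<And>y. y < x \<Longrightarrow> P y) \<Longrightarrow> P x"
  show "P a"
    by (induction "Rep_idx a" arbitrary: a rule: less_induct)
      (metis less_idx.rep_eq step)
qed (transfer; auto)+

end

lemma card_idx: "CARD('a::finite idx) = CARD('a)"
  using type_definition.card[OF type_definition_idx] by simp

instance idx :: (finite) finite
proof
  have "(UNIV :: 'a idx set) = Abs_idx ` {..<CARD('a)}"
    by (rule type_definition.Abs_image[OF type_definition_idx, symmetric])
  then show "finite (UNIV :: 'a idx set)"
    by (metis finite_imageI finite_lessThan)
qed

lemma prod_Basis_vec:
  "(\<Prod>b\<in>(Basis :: (real ^ 'n::finite) set). g b) = (\<Prod>i\<in>UNIV. g (axis i 1))"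
proof -
  have eq: "(Basis :: (real ^ 'n) set) = (\<lambda>i. axis i 1) ` UNIV"
    by (auto simp: Basis_vec_def)
  have inj: "inj (\<lambda>i. axis i 1 :: real ^ 'n)"
    by (auto simp: inj_on_def axis_eq_axis)
  show ?thesis unfolding eq by (simp add: prod.reindex[OF inj])
qed

text \<open>Relabelling coordinates pulls a box back to a box with the same side lengths, and the
  volumes of boxes determine \<open>lborel\<close>.\<close>

lemma lborel_distr_reindex:
  fixes e :: "'m::finite \<Rightarrow> 'n::finite"
  assumes e: "bij e"
  shows "distr lborel borel (\<lambda>x :: real ^ 'n. \<chi> k. x $ e k) = (lborel :: (real ^ 'm) measure)"
proof (rule lborel_eqI[symmetric])
  let ?T = "\<lambda>x :: real ^ 'n. \<chi> k. x $ e k"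
  have [measurable]: "?T \<in> borel \<rightarrow>\<^sub>M borel"
    by (intro borel_measurable_continuous_onI continuous_intros)
  fix l u :: "real ^ 'm" assume le: "\<And>b. b \<in> Basis \<Longrightarrow> l \<bullet> b \<le> u \<bullet> b"
  have lu: "l $ k \<le> u $ k" for k
    using le[of "axis k 1"] by (simp add: inner_axis)
  let ?l = "\<chi> i. l $ inv e i" and ?u = "\<chi> i. u $ inv e i"
  have "?T -` box l u = box ?l ?u"
  proof (rule set_eqI)
    fix x :: "real ^ 'n"
    have "(\<forall>k. l $ k < x $ e k \<and> x $ e k < u $ k) \<longleftrightarrow> (\<forall>i. l $ inv e i < x $ i \<and> x $ i < u $ inv e i)"
      using e by (metis bij_inv_eq_iff)
    then show "x \<in> ?T -` box l u \<longleftrightarrow> x \<in> box ?l ?u"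
      by (simp add: mem_box_cart)
  qed
  then have "emeasure (distr lborel borel ?T) (box l u) = emeasure lborel (box ?l ?u)"
    by (simp add: emeasure_distr)
  also have "\<dots> = (\<Prod>b\<in>Basis. (?u - ?l) \<bullet> b)"
    using lu by (intro emeasure_lborel_box) (auto simp: Basis_vec_def inner_axis)
  also have "(\<Prod>b\<in>Basis. (?u - ?l) \<bullet> b) = (\<Prod>i\<in>UNIV. u $ inv e i - l $ inv e i)"
    by (simp add: prod_Basis_vec inner_axis)
  also have "\<dots> = (\<Prod>k\<in>UNIV. u $ k - l $ k)"
    using prod.reindex_bij_betw[OF bij_imp_bij_inv[OF e], where g="\<lambda>k. u $ k - l $ k"] by simp
  also have "\<dots> = (\<Prod>b\<in>Basis. (u - l) \<bullet> b)"
    by (simp add: prod_Basis_vec inner_axis)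
  finally show "emeasure (distr lborel borel ?T) (box l u) = (\<Prod>b\<in>Basis. (u - l) \<bullet> b)" .
qed simp

lemma borel_measurable_orthogonal:
  fixes Q :: "'a::euclidean_space \<Rightarrow> 'a"
  assumes "orthogonal_transformation Q"
  shows "Q \<in> borel_measurable borel"
  using assms by (intro borel_measurable_continuous_onI linear_continuous_on)
    (simp add: orthogonal_transformation_linear linear_conv_bounded_linear[symmetric])

lemma lborel_distr_orthogonal_wellorder:
  fixes Q :: "real ^ 'n::{finite,wellorder} \<Rightarrow> real ^ 'n::_"
  assumes Q: "orthogonal_transformation Q"
  shows "distr lborel borel Q = lborel"
proof (rule lborel_eqI[symmetric])
  note [measurable] = borel_measurable_orthogonal[OF Q]
  fix l u :: "real ^ 'n::_" assume le: "\<And>b. b \<in> Basis \<Longrightarrow> l \<bullet> b \<le> u \<bullet> b"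
  have Q': "orthogonal_transformation (inv Q)" using Q by (rule orthogonal_transformation_inv)
  have im: "Q -` box l u = inv Q ` box l u"
    using Q by (simp add: bij_vimage_eq_inv_image orthogonal_transformation_bij)
  have lm: "inv Q ` box l u \<in> lmeasurable"
    by (rule measurable_orthogonal_image[OF Q']) simp
  have B: "Q -` box l u \<in> sets borel"
    using measurable_sets[OF borel_measurable_orthogonal[OF Q], of "box l u"] by simp
  have "emeasure (distr lborel borel Q) (box l u) = emeasure lebesgue (inv Q ` box l u)"
    using B by (simp add: emeasure_distr im[symmetric])
  also have "\<dots> = ennreal (measure lebesgue (inv Q ` box l u))"
    using lm by (simp add: emeasure_eq_measure2)
  also have "\<dots> = ennreal (measure lebesgue (box l u))"
    by (subst measure_orthogonal_image[OF Q']) simp_all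
  also have "\<dots> = emeasure lebesgue (box l u)"
    by (simp add: emeasure_eq_measure2)
  also have "\<dots> = (\<Prod>b\<in>Basis. (u - l) \<bullet> b)"
    using le by simp
  finally show "emeasure (distr lborel borel Q) (box l u) = (\<Prod>b\<in>Basis. (u - l) \<bullet> b)" .
qed simp

text \<open>Relabelling by \<open>e\<close> conjugates \<open>Q\<close> to an orthogonal map over
  the well-ordered index type. The relabellings \<open>T\<close> and \<open>S\<close> are mutually
  inverse and preserve both Lebesgue measure and inner products, so the result can be carried
  back.\<close>

lemma lborel_distr_orthogonal:
  fixes Q :: "real ^ 'n::finite \<Rightarrow> real ^ 'n"
  assumes Q: "orthogonal_transformation Q"
  shows "distr lborel borel Q = lborel"
proof -
  have "\<exists>e :: 'n idx \<Rightarrow> 'n. bij e"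
    by (rule finite_same_card_bij) (simp_all add: card_idx)
  then obtain e :: "'n idx \<Rightarrow> 'n" where e: "bij e" ..
  define T where "T = (\<lambda>x :: real ^ 'n. \<chi> k. x $ e k)"
  define S where "S = (\<lambda>x :: real ^ 'n idx. \<chi> i. x $ inv e i)"
  have ST: "S (T x) = x" and TS: "T (S y) = y" for x y
    using e by (simp_all add: S_def T_def vec_eq_iff bij_is_inj bij_is_surj surj_f_inv_f)
  have [measurable]: "T \<in> borel \<rightarrow>\<^sub>M borel" "S \<in> borel \<rightarrow>\<^sub>M borel"
    unfolding T_def S_def by (intro borel_measurable_continuous_onI continuous_intros)+
  note [measurable] = borel_measurable_orthogonal[OF Q]
  have dT: "distr lborel borel T = lborel" and dS: "distr lborel borel S = lborel"
    unfolding T_def S_def by (intro lborel_distr_reindex e bij_imp_bij_inv)+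
  have inn: "T x \<bullet> T y = x \<bullet> y" for x y
    using sum.reindex_bij_betw[OF e, where g="\<lambda>i. x $ i * y $ i"] by (simp add: inner_vec_def T_def)
  have innS: "S x \<bullet> S y = x \<bullet> y" for x y
    using inn[of "S x" "S y"] by (simp add: TS)
  have "linear T" "linear S"
    by (auto intro!: linearI simp: T_def S_def vec_eq_iff)
  then have "orthogonal_transformation (\<lambda>x. T (Q (S x)))"
    using Q by (auto simp: orthogonal_transformation_def inn innS
        intro!: linear_compose[where f=S and g="\<lambda>x. T (Q x)", unfolded o_def]
          linear_compose[where f=Q and g=T, unfolded o_def])
  then have d: "distr lborel borel (\<lambda>x. T (Q (S x))) = lborel"
    by (rule lborel_distr_orthogonal_wellorder)
  have "distr lborel borel Q = distr lborel borel (\<lambda>x. S (T (Q (S (T x)))))"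
    by (simp add: ST)
  also have "\<dots> = distr (distr (distr lborel borel T) borel (\<lambda>x. T (Q (S x)))) borel S"
    by (simp add: distr_distr o_def)
  also have "\<dots> = lborel"
    by (simp add: dT d dS)
  finally show ?thesis .
qed

text \<open>Passes from Borel to Lebesgue measurability: the pushforward identity makes preimages of
  null sets null, which is what measurability between completions requires.\<close>

lemma
  fixes Q :: "real ^ 'n::finite \<Rightarrow> real ^ 'n"
  assumes Q: "orthogonal_transformation Q"
  shows lebesgue_measurable_orthogonal: "Q \<in> lebesgue \<rightarrow>\<^sub>M lebesgue"
    and lebesgue_distr_orthogonal: "distr lebesgue lebesgue Q = lebesgue"
proof -
  note m = borel_measurable_orthogonal[OF Q]
  have m': "Q \<in> lebesgue \<rightarrow>\<^sub>M lborel"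
    using m by (simp add: measurable_completion)
  have d: "distr lebesgue lborel Q = lborel"
    using m lborel_distr_orthogonal[OF Q]
    by (simp add: distr_completion cong: distr_cong)
  show "Q \<in> lebesgue \<rightarrow>\<^sub>M lebesgue"
    by (rule completion.measurable_completion2[OF m']) (simp add: d)
  show "distr lebesgue lebesgue Q = lebesgue"
    using completion.completion_distr_eq[OF m'] by (simp add: d)
qed

lemma nn_integral_orthogonal:
  fixes Q :: "real ^ 'n::finite \<Rightarrow> real ^ 'n"
  assumes "orthogonal_transformation Q" and "f \<in> borel_measurable lebesgue"
  shows "(\<integral>\<^sup>+ y. f (Q y) \<partial>lebesgue) = (\<integral>\<^sup>+ y. f y \<partial>lebesgue)"
  using nn_integral_distr[OF lebesgue_measurable_orthogonal[OF assms(1)], of f] assms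
  by (simp add: lebesgue_distr_orthogonal)

lemma AE_orthogonal:
  fixes Q :: "real ^ 'n::finite \<Rightarrow> real ^ 'n"
  assumes "orthogonal_transformation Q" and "AE y in lebesgue. P y"
  shows "AE y in lebesgue. P (Q y)"
  using AE_distrD[OF lebesgue_measurable_orthogonal[OF assms(1)], of P] assms(2)
  unfolding lebesgue_distr_orthogonal[OF assms(1)] .


subsection \<open>Majorization by transfers between two coordinates\<close>

definition upd2 :: "'n \<Rightarrow> 'n \<Rightarrow> real ^ 'n::finite \<Rightarrow> real \<Rightarrow> real \<Rightarrow> real ^ 'n" where
  "upd2 i j a u v = (\<chi> l. if l = i then u else if l = j then v else a $ l)"

lemma upd2_nth [simp]:
  "upd2 i j a u v $ i = u"
  "i \<noteq> j \<Longrightarrow> upd2 i j a u v $ j = v"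
  "l \<noteq> i \<Longrightarrow> l \<noteq> j \<Longrightarrow> upd2 i j a u v $ l = a $ l"
  by (simp_all add: upd2_def)

lemma upd2_same [simp]: "upd2 i j a (a $ i) (a $ j) = a"
  by (simp add: upd2_def vec_eq_iff)

lemma sum_split2:
  fixes h :: "'n::finite \<Rightarrow> 'b::comm_monoid_add"
  assumes "i \<noteq> j"
  shows "(\<Sum>l\<in>UNIV. h l) = h i + h j + (\<Sum>l\<in>UNIV - {i, j}. h l)"
proof -
  have "(\<Sum>l\<in>UNIV. h l) = (\<Sum>l\<in>{i, j}. h l) + (\<Sum>l\<in>UNIV - {i, j}. h l)"
    by (subst sum.union_disjoint[symmetric]) (auto intro: sum.cong)
  then show ?thesis using assms by simp
qed

section \<open>Decreasing rearrangements and sums over index sets\<close>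

text \<open>Trades the sorted list for an enumeration of the indices, so that partial sums of the
  rearrangement become sums over index sets, which can be compared and reindexed.\<close>

lemma decreasing_rearr_enum:
  fixes a :: "real ^ 'n::finite"
  obtains e where "bij_betw e {..<CARD('n)} UNIV"
    and "\<And>l. l < CARD('n) \<Longrightarrow> a $ e l = decreasing_rearr a ! l"
    and "\<And>l m. l \<le> m \<Longrightarrow> m < CARD('n) \<Longrightarrow> a $ e m \<le> a $ e l"
    and "\<And>m. m \<le> CARD('n) \<Longrightarrow> sum_list (take m (decreasing_rearr a)) = (\<Sum>l<m. a $ e l)"
proof -
  obtain ks :: "'n list" where ks: "set ks = UNIV" "distinct ks"
    using finite_distinct_list[of "UNIV :: 'n set"] by auto
  define xs where "xs = sort_key (\<lambda>i. - a $ i) ks"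
  have xs: "set xs = UNIV" "distinct xs" "sorted (map (\<lambda>i. - a $ i) xs)"
    using ks by (simp_all add: xs_def)
  have len: "length xs = CARD('n)"
    using xs distinct_card[of xs] by simp
  have srt: "a $ (xs ! m) \<le> a $ (xs ! l)" if "l \<le> m" "m < CARD('n)" for l m
    using sorted_nth_mono[OF xs(3), of l m] that len by simp
  have "sorted (rev (map (\<lambda>i. a $ i) xs))"
    using srt by (auto simp: sorted_rev_iff_nth_mono len)
  moreover have "mset (rev (map (\<lambda>i. a $ i) xs)) = image_mset (\<lambda>i. a $ i) (mset_set UNIV)"
    using xs mset_set_set[of xs] by simp
  ultimately have "rev (map (\<lambda>i. a $ i) xs) = sorted_list_of_multiset (image_mset (\<lambda>i. a $ i) (mset_set UNIV))"
    by (metis sorted_list_of_multiset_mset sorted_sort_id)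
  then have d: "decreasing_rearr a = map (\<lambda>i. a $ i) xs"
    unfolding decreasing_rearr_def by (metis rev_rev_ident)
  show thesis
  proof
    show "bij_betw ((!) xs) {..<CARD('n)} UNIV"
      by (rule bij_betw_nth) (use xs len in auto)
    show "a $ (xs ! l) = decreasing_rearr a ! l" if "l < CARD('n)" for l
      using that len by (simp add: d)
    show "a $ (xs ! m) \<le> a $ (xs ! l)" if "l \<le> m" "m < CARD('n)" for l m
      using srt that by blast
    show "sum_list (take m (decreasing_rearr a)) = (\<Sum>l<m. a $ (xs ! l))" if "m \<le> CARD('n)" for m
      using that len by (simp add: d sum_list_sum_nth atLeast0LessThan min_def)
  qed
qed

lemma decreasing_rearr_permute:
  fixes a :: "real ^ 'n::finite"
  assumes "bij \<pi>"
  shows "decreasing_rearr (\<chi> l. a $ \<pi> l) = decreasing_rearr a"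
proof -
  have "image_mset (\<lambda>i. a $ \<pi> i) (mset_set UNIV)
      = image_mset (\<lambda>i. a $ i) (image_mset \<pi> (mset_set UNIV))"
    by (simp add: image_mset.compositionality o_def)
  also have "image_mset \<pi> (mset_set UNIV) = mset_set UNIV"
    using assms by (simp add: image_mset_mset_set bij_is_inj bij_is_surj)
  finally show ?thesis by (simp add: decreasing_rearr_def)
qed

text \<open>\<open>T\<close> and \<open>{..<card T}\<close> have equally many elements outside their
  intersection. On those of \<open>T\<close>, \<open>d\<close> is at most
  \<open>d (card T - 1)\<close>; on those of the initial segment it is at least that value.\<close>

lemma sum_le_sum_initial:
  fixes d :: "nat \<Rightarrow> real"
  assumes d: "\<And>l m. l \<le> m \<Longrightarrow> m < n \<Longrightarrow> d m \<le> d l" and T: "T \<subseteq> {..<n}"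
  shows "sum d T \<le> sum d {..<card T}"
proof (cases "card T = 0")
  case True
  then show ?thesis using T finite_subset[OF T] by auto
next
  case False
  let ?A = "{..<card T}"
  have fin: "finite T" using T finite_subset by blast
  have le: "card T \<le> n" using card_mono[OF _ T] by simp
  have "card T = card (T \<inter> ?A) + card (T - ?A)" "card ?A = card (T \<inter> ?A) + card (?A - T)"
    using fin by (metis card_Int_Diff, metis card_Int_Diff finite_lessThan inf_commute)
  then have c: "card (T - ?A) = card (?A - T)" by simp
  have "sum d T = sum d (T \<inter> ?A) + sum d (T - ?A)"
    using fin by (simp add: sum.Int_Diff)
  also have "sum d (T - ?A) \<le> of_nat (card (T - ?A)) * d (card T - 1)"
    using T by (intro sum_bounded_above d) auto
  also have "\<dots> = of_nat (card (?A - T)) * d (card T - 1)" using c by simp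
  also have "\<dots> \<le> sum d (?A - T)"
    using le False by (intro sum_bounded_below d) auto
  also have "sum d (T \<inter> ?A) + \<dots> = sum d ?A"
    using sum.Int_Diff[of ?A d T] by (simp add: inf_commute)
  finally show ?thesis by simp
qed

text \<open>Partial sums of the decreasing rearrangement are the largest sums over index sets of
  given size. This half allows majorization to be checked by exhibiting a suitable index
  set.\<close>

lemma sum_le_sum_list_take_decreasing_rearr:
  fixes a :: "real ^ 'n::finite"
  shows "(\<Sum>i\<in>S. a $ i) \<le> sum_list (take (card S) (decreasing_rearr a))"
proof -
  obtain e where e: "bij_betw e {..<CARD('n)} UNIV"
    and mono: "\<And>l m. l \<le> m \<Longrightarrow> m < CARD('n) \<Longrightarrow> a $ e m \<le> a $ e l"
    and sums: "\<And>m. m \<le> CARD('n) \<Longrightarrow> sum_list (take m (decreasing_rearr a)) = (\<Sum>l<m. a $ e l)"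
    using decreasing_rearr_enum[of a] by metis
  define T where "T = {l. l < CARD('n) \<and> e l \<in> S}"
  have ST: "S = e ` T"
    using e by (force simp: T_def bij_betw_def)
  have inj: "inj_on e T"
    using e by (auto simp: bij_betw_def T_def intro: inj_on_subset)
  have "(\<Sum>i\<in>S. a $ i) = (\<Sum>l\<in>T. a $ e l)"
    unfolding ST by (simp add: sum.reindex[OF inj])
  also have "\<dots> \<le> (\<Sum>l<card T. a $ e l)"
    by (rule sum_le_sum_initial[where n="CARD('n)"]) (use mono in \<open>auto simp: T_def\<close>)
  also have "card T = card S"
    unfolding ST by (simp add: card_image[OF inj])
  finally show ?thesis
    by (simp add: sums card_mono)
qed

text \<open>Let \<open>S\<close> carry the \<open>m\<close> largest coordinates of \<open>b\<close>.
  If \<open>S\<close> contains both or neither of \<open>i\<close> and \<open>j\<close>, its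
  \<open>a\<close>-sum and \<open>b\<close>-sum agree; if it contains just one, the set using
  \<open>i\<close> in its place has an \<open>a\<close>-sum at least as large.\<close>

lemma majorizes_transfer:
  fixes a b :: "real ^ 'n::finite"
  assumes ij: "i \<noteq> j" and same: "\<And>l. l \<noteq> i \<Longrightarrow> l \<noteq> j \<Longrightarrow> a $ l = b $ l"
    and sum: "a $ i + a $ j = b $ i + b $ j" and "b $ i \<le> a $ i" "b $ j \<le> a $ i"
  shows "majorizes a b"
  unfolding majorizes_def
proof (intro conjI ballI)
  show "(\<Sum>i\<in>UNIV. a $ i) = (\<Sum>i\<in>UNIV. b $ i)"
    using same sum by (simp add: sum_split2[OF ij])
  fix m assume "m \<in> {1..CARD('n)}"
  then have m: "m \<le> CARD('n)" by simp
  obtain e where e: "bij_betw e {..<CARD('n)} UNIV"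
    and sums: "\<And>m. m \<le> CARD('n) \<Longrightarrow> sum_list (take m (decreasing_rearr b)) = (\<Sum>l<m. b $ e l)"
    using decreasing_rearr_enum[of b] by metis
  define S where "S = e ` {..<m}"
  have inj: "inj_on e {..<m}"
    using e m by (auto simp: bij_betw_def intro: inj_on_subset)
  have S: "sum_list (take m (decreasing_rearr b)) = (\<Sum>i\<in>S. b $ i)" and cS: "card S = m"
    using m by (simp_all add: sums S_def sum.reindex[OF inj] card_image[OF inj])
  define R where "R = S - {i, j}"
  have R: "(\<Sum>l\<in>R. a $ l) = (\<Sum>l\<in>R. b $ l)" "i \<notin> R" "j \<notin> R"
    using same by (auto simp: R_def intro: sum.cong)
  have "\<exists>S'. card S' = card S \<and> (\<Sum>i\<in>S. b $ i) \<le> (\<Sum>i\<in>S'. a $ i)"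
  proof (cases "i \<in> S")
    case True
    show ?thesis
    proof (cases "j \<in> S")
      case True
      then have "S = insert i (insert j R)" using \<open>i \<in> S\<close> by (auto simp: R_def)
      then show ?thesis using R ij sum by (intro exI[of _ S]) simp
    next
      case False
      then have "S = insert i R" using \<open>i \<in> S\<close> by (auto simp: R_def)
      then show ?thesis using R assms by (intro exI[of _ S]) simp
    qed
  next
    case False
    show ?thesis
    proof (cases "j \<in> S")
      case True
      then have "S = insert j R" using False by (auto simp: R_def)
      then show ?thesis using R assms by (intro exI[of _ "insert i R"]) simp
    next
      case j: False
      then have "S = R" using False by (auto simp: R_def)
      then show ?thesis using R by (intro exI[of _ S]) simp
    qed
  qed
  then show "sum_list (take m (decreasing_rearr b)) \<le> sum_list (take m (decreasing_rearr a))"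
    using sum_le_sum_list_take_decreasing_rearr[of a] unfolding S cS by (metis order.trans)
qed

section \<open>Decomposition of majorization into transfers\<close>

text \<open>The Hardy--Littlewood--Polya construction, by induction on the number of coordinates
  where \<open>a\<close> and \<open>b\<close> differ. Each transfer makes at least one more
  coordinate agree with \<open>b\<close> and keeps the partial sums dominating. Only
  \<open>b\<close> is decreasing along \<open>e\<close>; the intermediate vectors may fail to
  be.\<close>

lemma transfer_chain:
  fixes a b :: "real ^ 'n::finite" and L :: "real ^ 'n \<Rightarrow> real ^ 'n \<Rightarrow> bool"
  assumes trans: "\<And>x y z. L x y \<Longrightarrow> L y z \<Longrightarrow> L x z"
    and step: "\<And>x i j \<delta>. x \<in> nonneg_orthant \<Longrightarrow> i \<noteq> j \<Longrightarrow> 0 < \<delta> \<Longrightarrow>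
      x $ j + \<delta> \<le> x $ i - \<delta> \<Longrightarrow> L x (upd2 i j x (x $ i - \<delta>) (x $ j + \<delta>))"
    and e: "bij_betw e {..<CARD('n)} UNIV"
    and b: "b \<in> nonneg_orthant" "\<And>l m. l \<le> m \<Longrightarrow> m < CARD('n) \<Longrightarrow> b $ e m \<le> b $ e l"
    and a: "a \<in> nonneg_orthant" "a \<noteq> b"
    and sums: "\<And>m. m \<le> CARD('n) \<Longrightarrow> (\<Sum>l<m. b $ e l) \<le> (\<Sum>l<m. a $ e l)"
    and tot: "(\<Sum>l<CARD('n). a $ e l) = (\<Sum>l<CARD('n). b $ e l)"
  shows "L a b"
  using a sums tot
proof (induction "card {l. a $ l \<noteq> b $ l}" arbitrary: a rule: less_induct)
  case less
  define D where "D l = a $ e l - b $ e l" for l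
  have sumD: "0 \<le> (\<Sum>l<m. D l)" if "m \<le> CARD('n)" for m
    using less.prems(3)[OF that] by (simp add: D_def sum_subtractf)
  have e_inj: "e l = e m \<longleftrightarrow> l = m" if "l < CARD('n)" "m < CARD('n)" for l m
    using e that by (auto simp: bij_betw_def inj_on_def)
  have "\<exists>k. k < CARD('n) \<and> D k < 0"
  proof (rule ccontr)
    assume "\<not> ?thesis"
    then have "\<And>l. l \<in> {..<CARD('n)} \<Longrightarrow> 0 \<le> D l" by force
    moreover have "(\<Sum>l<CARD('n). D l) = 0"
      using less.prems(4) by (simp add: D_def sum_subtractf)
    ultimately have "\<forall>l\<in>{..<CARD('n)}. D l = 0"
      by (subst (asm) sum_nonneg_eq_0_iff) auto
    then have "a $ i = b $ i" for i
      using e by (metis (mono_tags) D_def bij_betw_imp_surj_on eq_iff_diff_eq_0 iso_tuple_UNIV_I image_iff)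
    then show False using less.prems(2) by (simp add: vec_eq_iff)
  qed
  \<comment> \<open>\<open>k\<close> is the first index with a deficit. Nonnegativity of the partial
    sum through \<open>k\<close> then forces an earlier index \<open>j\<close> with a
    surplus.\<close>
  then obtain k where k: "k < CARD('n)" "D k < 0"
    and k_least: "\<And>l. l < k \<Longrightarrow> \<not> (l < CARD('n) \<and> D l < 0)"
    unfolding exists_least_iff[of "\<lambda>k. k < CARD('n) \<and> D k < 0"] by blast
  have k_min: "0 \<le> D l" if "l < k" for l
    using k_least[OF that] that k(1) by simp
  have "\<exists>j<k. 0 < D j"
  proof (rule ccontr)
    assume "\<not> ?thesis"
    then have "(\<Sum>l<k. D l) \<le> 0" by (intro sum_nonpos) force
    then show False using sumD[of "Suc k"] k by simp
  qed
  then obtain j where j: "j < k" "0 < D j" by blast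
  \<comment> \<open>The largest amount that overshoots neither target: afterwards coordinate
    \<open>e j\<close> or \<open>e k\<close> equals its value in \<open>b\<close>. As
    \<open>b\<close> is decreasing along \<open>e\<close>, \<open>a $ e k + \<delta> \<le> b $ e k
    \<le> b $ e j \<le> a $ e j - \<delta>\<close>, which is what \<open>step\<close>
    requires.\<close>
  define \<delta> where "\<delta> = min (D j) (- D k)"
  have \<delta>: "0 < \<delta>" "\<delta> \<le> D j" "\<delta> \<le> - D k" using j k by (auto simp: \<delta>_def)
  have jk: "e j \<noteq> e k" using j k e_inj by simp
  define a' where "a' = upd2 (e j) (e k) a (a $ e j - \<delta>) (a $ e k + \<delta>)"
  have b_jk: "b $ e k \<le> b $ e j" using b j k by simp
  have La: "L a a'"
    unfolding a'_def using \<delta> b_jk by (intro step less.prems jk) (auto simp: D_def)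
  show "L a b"
  proof (cases "a' = b")
    case True
    then show ?thesis using La by simp
  next
    case False
    have a'_nth: "a' $ e l = a $ e l - (if l = j then \<delta> else 0) + (if l = k then \<delta> else 0)"
      if "l < CARD('n)" for l
    proof -
      have "e l = e j \<longleftrightarrow> l = j" "e l = e k \<longleftrightarrow> l = k" "j \<noteq> k" using that j k e_inj by auto
      then show ?thesis using jk by (auto simp: a'_def)
    qed
    have sum': "(\<Sum>l<m. a' $ e l) = (\<Sum>l<m. a $ e l) - (if j < m then \<delta> else 0) + (if k < m then \<delta> else 0)"
      if "m \<le> CARD('n)" for m
    proof -
      have "(\<Sum>l<m. a' $ e l) = (\<Sum>l<m. a $ e l - (if l = j then \<delta> else 0) + (if l = k then \<delta> else 0))"
        using that by (intro sum.cong a'_nth) auto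
      then show ?thesis
        by (simp add: sum.distrib sum_subtractf)
    qed
    have "L a' b"
    proof (rule less.hyps)
      let ?X = "{l. a $ l \<noteq> b $ l}"
      have other: "a' $ l = a $ l" if "l \<noteq> e j" "l \<noteq> e k" for l
        using that by (simp add: a'_def)
      have "a' $ e j = b $ e j \<or> a' $ e k = b $ e k"
        using jk by (auto simp: a'_def \<delta>_def D_def min_def)
      then have "e j \<notin> {l. a' $ l \<noteq> b $ l} \<or> e k \<notin> {l. a' $ l \<noteq> b $ l}"
        by simp
      moreover have X: "e j \<in> ?X" "e k \<in> ?X" using j k by (auto simp: D_def)
      moreover have "{l. a' $ l \<noteq> b $ l} \<subseteq> ?X"
      proof
        fix l assume "l \<in> {l. a' $ l \<noteq> b $ l}"
        then show "l \<in> ?X"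
          using X other[of l] by (cases "l = e j"; cases "l = e k") auto
      qed
      ultimately have "{l. a' $ l \<noteq> b $ l} \<subset> ?X"
        by blast
      then show "card {l. a' $ l \<noteq> b $ l} < card ?X"
        by (intro psubset_card_mono) auto
      have "0 \<le> a' $ l" for l
      proof -
        have "0 \<le> a $ e k" "0 \<le> b $ e j" "0 \<le> a $ l"
          using less.prems(1) b(1) by (auto simp: nonneg_orthant_def)
        then show ?thesis using \<delta> jk by (auto simp: a'_def upd2_def D_def)
      qed
      then show "a' \<in> nonneg_orthant" by (simp add: nonneg_orthant_def)
      show "a' \<noteq> b" by fact
      show "(\<Sum>l<CARD('n). a' $ e l) = (\<Sum>l<CARD('n). b $ e l)"
        using less.prems(4) j k by (simp add: sum')
      fix m assume m: "m \<le> CARD('n)"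
      \<comment> \<open>Only partial sums that include \<open>j\<close> but not \<open>k\<close>
        drop. Every \<open>D l\<close> occurring there is nonnegative, so the surplus is at least
        \<open>D j\<close>, hence at least \<delta>.\<close>
      show "(\<Sum>l<m. b $ e l) \<le> (\<Sum>l<m. a' $ e l)"
      proof (cases "j < m \<and> m \<le> k")
        case True
        have "D j \<le> (\<Sum>l<m. D l)"
          using True k_min by (intro member_le_sum) auto
        then show ?thesis
          using True m \<delta> by (simp add: sum' D_def sum_subtractf)
      next
        case False
        then show ?thesis using less.prems(3)[OF m] j by (auto simp: sum'[OF m])
      qed
    qed
    then show ?thesis using La trans by blast
  qed
qed

text \<open>Matching the sorted enumerations of \<open>a\<close> and \<open>b\<close> position by
  position gives the permutation.\<close>

lemma decreasing_rearr_eq_imp_permute: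
  fixes a b :: "real ^ 'n::finite"
  assumes "decreasing_rearr a = decreasing_rearr b"
  obtains \<pi> where "bij \<pi>" "b = (\<chi> l. a $ \<pi> l)"
proof -
  obtain ea where ea: "bij_betw ea {..<CARD('n)} UNIV"
    "\<And>l. l < CARD('n) \<Longrightarrow> a $ ea l = decreasing_rearr a ! l"
    using decreasing_rearr_enum[of a] by metis
  obtain eb where eb: "bij_betw eb {..<CARD('n)} UNIV"
    "\<And>l. l < CARD('n) \<Longrightarrow> b $ eb l = decreasing_rearr b ! l"
    using decreasing_rearr_enum[of b] by metis
  let ?\<pi> = "ea \<circ> inv_into {..<CARD('n)} eb"
  have "bij ?\<pi>"
    using bij_betw_trans[OF bij_betw_inv_into[OF eb(1)] ea(1)] .
  moreover have "b = (\<chi> l. a $ ?\<pi> l)"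
  proof (simp add: vec_eq_iff, rule allI)
    fix l
    define m where "m = inv_into {..<CARD('n)} eb l"
    have "m \<in> {..<CARD('n)}" "eb m = l"
      using eb(1) by (auto simp: m_def bij_betw_def inv_into_into f_inv_into_f simp del: lessThan_iff)
    then show "b $ l = a $ ea (inv_into {..<CARD('n)} eb l)"
      using ea(2)[of m] eb(2)[of m] assms by (simp add: m_def)
  qed
  ultimately show thesis using that by blast
qed

text \<open>Permuting \<open>a\<close> into the order of \<open>b\<close> meets the hypotheses of
  \<open>transfer_chain\<close>, and \<open>perm\<close> undoes the permutation. Strictness makes
  the permuted \<open>a\<close> differ from \<open>b\<close>, so at least one transfer occurs;
  \<open>L\<close> may therefore be a strict comparison.\<close>

lemma strictly_majorizes_induct:
  fixes a b :: "real ^ 'n::finite" and L :: "real ^ 'n \<Rightarrow> real ^ 'n \<Rightarrow> bool"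
  assumes maj: "strictly_majorizes a b"
    and ab: "a \<in> nonneg_orthant" "b \<in> nonneg_orthant"
    and trans: "\<And>x y z. L x y \<Longrightarrow> L y z \<Longrightarrow> L x z"
    and step: "\<And>x i j \<delta>. x \<in> nonneg_orthant \<Longrightarrow> i \<noteq> j \<Longrightarrow> 0 < \<delta> \<Longrightarrow>
      x $ j + \<delta> \<le> x $ i - \<delta> \<Longrightarrow> L x (upd2 i j x (x $ i - \<delta>) (x $ j + \<delta>))"
    and perm: "\<And>x y \<pi>. bij \<pi> \<Longrightarrow> L (\<chi> l. x $ \<pi> l) y \<Longrightarrow> L x y"
  shows "L a b"
proof -
  obtain ea where ea: "bij_betw ea {..<CARD('n)} UNIV"
    "\<And>m. m \<le> CARD('n) \<Longrightarrow> sum_list (take m (decreasing_rearr a)) = (\<Sum>l<m. a $ ea l)"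
    using decreasing_rearr_enum[of a] by metis
  obtain eb where eb: "bij_betw eb {..<CARD('n)} UNIV"
    "\<And>l m. l \<le> m \<Longrightarrow> m < CARD('n) \<Longrightarrow> b $ eb m \<le> b $ eb l"
    "\<And>m. m \<le> CARD('n) \<Longrightarrow> sum_list (take m (decreasing_rearr b)) = (\<Sum>l<m. b $ eb l)"
    using decreasing_rearr_enum[of b] by metis
  define \<pi> where "\<pi> = ea \<circ> inv_into {..<CARD('n)} eb"
  have \<pi>: "bij \<pi>"
    unfolding \<pi>_def using bij_betw_trans[OF bij_betw_inv_into[OF eb(1)] ea(1)] .
  have \<pi>_eb: "\<pi> (eb l) = ea l" if "l < CARD('n)" for l
    using that eb(1) by (simp add: \<pi>_def bij_betw_def)
  have sums: "(\<Sum>l<m. b $ eb l) \<le> (\<Sum>l<m. (\<chi> l. a $ \<pi> l) $ eb l)" if "m \<le> CARD('n)" for m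
  proof (cases "m = 0")
    case False
    then have "sum_list (take m (decreasing_rearr b)) \<le> sum_list (take m (decreasing_rearr a))"
      using maj that by (simp add: strictly_majorizes_def majorizes_def)
    then show ?thesis using that by (simp add: ea eb \<pi>_eb)
  qed simp
  have "L (\<chi> l. a $ \<pi> l) b"
  proof (rule transfer_chain[where e=eb])
    show "(\<Sum>l<CARD('n). (\<chi> l. a $ \<pi> l) $ eb l) = (\<Sum>l<CARD('n). b $ eb l)"
      using maj sum.reindex_bij_betw[OF ea(1), of "\<lambda>i. a $ i"] sum.reindex_bij_betw[OF eb(1), of "\<lambda>i. b $ i"]
      by (simp add: strictly_majorizes_def majorizes_def \<pi>_eb)
    show "(\<chi> l. a $ \<pi> l) \<noteq> b"
      using maj decreasing_rearr_permute[OF \<pi>, of a] by (auto simp: strictly_majorizes_def)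
    show "(\<chi> l. a $ \<pi> l) \<in> nonneg_orthant"
      using ab by (simp add: nonneg_orthant_def)
  qed (fact trans step eb ab sums)+
  then show ?thesis by (rule perm[OF \<pi>])
qed


subsection \<open>Reflections and Gaussian convolution\<close>

text \<open>For nonzero \<open>w\<close> the reflection in the hyperplane orthogonal to
  \<open>w\<close>; for \<open>w = 0\<close> the identity, so that \<open>householder w\<close> is
  always an orthogonal involution.\<close>

definition householder :: "'a::real_inner \<Rightarrow> 'a \<Rightarrow> 'a" where
  "householder w y = y - (2 * (w \<bullet> y) / (w \<bullet> w)) *\<^sub>R w"

lemma orthogonal_transformation_refl: "orthogonal_transformation (householder w)"
proof -
  have "householder w x \<bullet> householder w y = x \<bullet> y" for x y
    by (cases "w = 0") (simp_all add: householder_def inner_diff_left inner_diff_right inner_commute field_simps)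
  moreover have "linear (householder w)"
    by (rule linearI) (simp_all add: householder_def inner_add_right algebra_simps add_divide_distrib)
  ultimately show ?thesis by (simp add: orthogonal_transformation_def)
qed

lemma householder_refl [simp]: "householder w (householder w y) = y"
  by (cases "w = 0") (simp_all add: householder_def inner_diff_right field_simps)

lemma householder_scaleR: "k \<noteq> 0 \<Longrightarrow> householder (k *\<^sub>R w) = householder w"
  by (rule ext) (simp add: householder_def)

text \<open>The constants stay free: the inequalities below use only that \<open>c\<close> and
  \<open>s\<close> are positive, and the normalization enters at the very end.\<close>

definition gauss_kernel :: "real \<Rightarrow> real \<Rightarrow> 'a::euclidean_space \<Rightarrow> 'a \<Rightarrow> real" where
  "gauss_kernel c s x y = c * exp (- s * (norm (y - x))\<^sup>2)"

definition gauss_conv :: "real \<Rightarrow> real \<Rightarrow> ('a::euclidean_space \<Rightarrow> ennreal) \<Rightarrow> 'a \<Rightarrow> ennreal" where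
  "gauss_conv c s f x = (\<integral>\<^sup>+ y. f y * ennreal (gauss_kernel c s x y) \<partial>lebesgue)"

lemma gauss_kernel_orthogonal:
  assumes "orthogonal_transformation Q"
  shows "gauss_kernel c s (Q x) (Q y) = gauss_kernel c s x y"
  using orthogonal_transformation_norm[OF assms, of "y - x"]
  by (simp add: gauss_kernel_def linear_diff[OF orthogonal_transformation_linear[OF assms]])

lemma gauss_kernel_measurable [measurable]: "gauss_kernel c s x \<in> borel_measurable borel"
  unfolding gauss_kernel_def by measurable

lemma gauss_kernel_lebesgue [measurable]:
  "(\<lambda>y. ennreal (gauss_kernel c s x y)) \<in> borel_measurable lebesgue"
proof -
  have "(\<lambda>y. ennreal (gauss_kernel c s x y)) \<in> borel_measurable lborel" by simp
  then show ?thesis by (rule measurable_completion)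
qed

text \<open>Change of variables by \<open>Q\<close>; the kernel is unchanged when \<open>Q\<close>
  acts on both of its arguments.\<close>

lemma gauss_conv_orthogonal:
  fixes f :: "real ^ 'n::finite \<Rightarrow> ennreal" and Q :: "real ^ 'n \<Rightarrow> real ^ 'n"
  assumes Q: "orthogonal_transformation Q" and f: "f \<in> borel_measurable lebesgue"
  shows "gauss_conv c s f (Q x) = (\<integral>\<^sup>+ y. f (Q y) * ennreal (gauss_kernel c s x y) \<partial>lebesgue)"
proof -
  have *: "(\<lambda>y. f y * ennreal (gauss_kernel c s (Q x) y)) \<in> borel_measurable lebesgue"
    using f by measurable
  from nn_integral_orthogonal[OF Q *] show ?thesis
    by (simp add: gauss_conv_def gauss_kernel_orthogonal[OF Q])
qed

lemma gauss_conv_orthogonal_invariant: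
  fixes f :: "real ^ 'n::finite \<Rightarrow> ennreal"
  assumes "orthogonal_transformation Q" "f \<in> borel_measurable lebesgue"
    and "AE y in lebesgue. f (Q y) = f y"
  shows "gauss_conv c s f (Q x) = gauss_conv c s f x"
  unfolding gauss_conv_orthogonal[OF assms(1,2)] unfolding gauss_conv_def
  by (rule nn_integral_cong_AE) (use assms(3) in auto)

section \<open>Monotonicity of quotients of hyperbolic sines\<close>

text \<open>The quotient \<open>sinh (k * x) / sinh x\<close> strictly decreases for positive
  \<open>x\<close>: the numerator of its derivative vanishes at 0 and has the negative derivative
  \<open>(k\<^sup>2 - 1) * (sinh (k * t) * sinh t)\<close>.\<close>

lemma sinh_mult_less:
  fixes p q k :: real
  assumes k: "0 < k" "k < 1" and pq: "0 < q" "q < p"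
  shows "sinh (k * p) * sinh q < sinh p * sinh (k * q)"
proof -
  let ?h = "\<lambda>x. sinh (k * x) / sinh x"
  have d_neg: "k * cosh (k * x) * sinh x - sinh (k * x) * cosh x < 0" if "0 < x" for x
  proof -
    let ?d = "\<lambda>x. k * cosh (k * x) * sinh x - sinh (k * x) * cosh x"
    have "?d x < ?d 0"
    proof (rule DERIV_neg_imp_decreasing_open[OF that])
      fix t :: real assume t: "0 < t" "t < x"
      have "(?d has_real_derivative (k\<^sup>2 - 1) * (sinh (k * t) * sinh t)) (at t)"
        by (auto intro!: derivative_eq_intros simp: algebra_simps power2_eq_square)
      moreover have "(k\<^sup>2 - 1) * (sinh (k * t) * sinh t) < 0"
        using k t by (intro mult_neg_pos mult_pos_pos) (auto simp: power2_eq_square intro: mult_strict_mono'[of k 1 k 1, simplified])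
      ultimately show "\<exists>y. (?d has_real_derivative y) (at t) \<and> y < 0" by blast
    qed (intro continuous_intros)
    then show ?thesis by simp
  qed
  have "?h p < ?h q"
  proof (rule DERIV_neg_imp_decreasing[OF pq(2)])
    fix x assume "q \<le> x" "x \<le> p"
    then have x: "0 < x" using pq by simp
    have "(?h has_real_derivative (k * cosh (k * x) * sinh x - sinh (k * x) * cosh x) / (sinh x * sinh x)) (at x)"
      using x by (auto intro!: derivative_eq_intros simp: algebra_simps)
    moreover have "(k * cosh (k * x) * sinh x - sinh (k * x) * cosh x) / (sinh x * sinh x) < 0"
      using d_neg[OF x] x by (intro divide_neg_pos mult_pos_pos) auto
    ultimately show "\<exists>y. (?h has_real_derivative y) (at x) \<and> y < 0" by blast
  qed
  then show ?thesis using pq by (simp add: field_simps)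
qed

text \<open>Both arguments of \<open>sgn\<close> are odd in \<open>p\<close>, odd in
  \<open>q\<close>, and change sign when \<open>p\<close> and \<open>q\<close> are exchanged, which
  leaves the case of \<open>sinh_mult_less\<close>. This determines the sign of
  \<open>K1 - K2\<close> in \<open>gauss_conv_frame_point\<close>.\<close>

lemma sinh_mult_sgn:
  fixes p q k :: real
  assumes k: "0 < k" "k < 1"
  shows "sgn (sinh p * sinh (k * q) - sinh (k * p) * sinh q) = sgn (p * q * (p\<^sup>2 - q\<^sup>2))"
proof -
  let ?S = "\<lambda>p q. sinh p * sinh (k * q) - sinh (k * p) * sinh q"
  have pos: "sgn (?S p q) = sgn (p * q * (p\<^sup>2 - q\<^sup>2))" if "0 < p" "0 < q" for p q
  proof -
    consider "q < p" | "p < q" | "p = q" by linarith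
    then show ?thesis
    proof cases
      case 1
      then have "q\<^sup>2 < p\<^sup>2" using that by (intro power_strict_mono) auto
      then show ?thesis using sinh_mult_less[OF k that(2) 1] that by simp
    next
      case 2
      then have "p\<^sup>2 < q\<^sup>2" using that by (intro power_strict_mono) auto
      then have "p * q * (p\<^sup>2 - q\<^sup>2) < 0" using that by (intro mult_pos_neg) auto
      then show ?thesis using sinh_mult_less[OF k that(1) 2] by (simp add: mult.commute)
    qed simp
  qed
  have flip: "sgn (?S p q) = sgn (p * q * (p\<^sup>2 - q\<^sup>2))" if "0 < \<bar>p\<bar>" "0 < q" for p q
  proof (cases "0 < p")
    case False
    then have "sgn (?S (- p) q) = sgn ((- p) * q * ((- p)\<^sup>2 - q\<^sup>2))"
      using that by (intro pos) auto
    moreover have "?S (- p) q = - ?S p q" "(- p) * q * ((- p)\<^sup>2 - q\<^sup>2) = - (p * q * (p\<^sup>2 - q\<^sup>2))"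
      by (simp_all add: algebra_simps)
    ultimately show ?thesis by (simp only: sgn_minus neg_equal_iff_equal)
  qed (use pos that in auto)
  consider "p = 0" | "q = 0" | "0 < \<bar>p\<bar>" "0 < q" | "0 < \<bar>p\<bar>" "q < 0" by linarith
  then show ?thesis
  proof cases
    case 4
    then have "sgn (?S p (- q)) = sgn (p * (- q) * (p\<^sup>2 - (- q)\<^sup>2))"
      by (intro flip) auto
    moreover have "?S p (- q) = - ?S p q" "p * (- q) * (p\<^sup>2 - (- q)\<^sup>2) = - (p * q * (p\<^sup>2 - q\<^sup>2))"
      by (simp_all add: algebra_simps)
    ultimately show ?thesis by (simp only: sgn_minus neg_equal_iff_equal)
  qed (use flip in auto)
qed

section \<open>Symmetries of Schur-square-concave functions and of their convolutions\<close>

lemma schur2_concave_transfer: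
  fixes f :: "real ^ 'n::finite \<Rightarrow> ennreal"
  assumes f: "schur2_concave f" and ij: "i \<noteq> j"
    and "(x $ i)\<^sup>2 + (x $ j)\<^sup>2 = (y $ i)\<^sup>2 + (y $ j)\<^sup>2"
    and "(y $ i)\<^sup>2 \<le> (x $ i)\<^sup>2" "(y $ j)\<^sup>2 \<le> (x $ i)\<^sup>2"
    and "\<And>l. l \<noteq> i \<Longrightarrow> l \<noteq> j \<Longrightarrow> (x $ l)\<^sup>2 = (y $ l)\<^sup>2"
  shows "f x \<le> f y"
proof -
  obtain g where g: "schur_concave_on nonneg_orthant g" "\<And>x. f x = g (\<chi> i. (x $ i)\<^sup>2)"
    using f by (auto simp: schur2_concave_def)
  have "majorizes (\<chi> i. (x $ i)\<^sup>2) (\<chi> i. (y $ i)\<^sup>2)"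
    by (rule majorizes_transfer[OF ij]) (use assms in auto)
  then show ?thesis using g(1) unfolding g(2) by (auto simp: schur_concave_on_def nonneg_orthant_def)
qed

lemma schur2_concave_abs:
  fixes f :: "real ^ 'n::finite \<Rightarrow> ennreal"
  assumes f: "schur2_concave f" and "\<And>l. (x $ l)\<^sup>2 = (y $ l)\<^sup>2"
  shows "f x = f y"
proof -
  obtain g where "\<And>x. f x = g (\<chi> i. (x $ i)\<^sup>2)"
    using f by (auto simp: schur2_concave_def)
  then show ?thesis using assms by simp
qed

text \<open>Vectors with the same decreasing rearrangement majorize each other, so \<open>g\<close>
  takes the same value at both.\<close>

lemma schur2_concave_permute:
  fixes f :: "real ^ 'n::finite \<Rightarrow> ennreal"
  assumes f: "schur2_concave f" and \<pi>: "bij \<pi>"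
  shows "f (\<chi> l. x $ \<pi> l) = f x"
proof -
  obtain g where g: "schur_concave_on nonneg_orthant g" "\<And>x. f x = g (\<chi> i. (x $ i)\<^sup>2)"
    using f by (auto simp: schur2_concave_def)
  let ?a = "\<chi> l. (x $ l)\<^sup>2" and ?b = "\<chi> l. (x $ \<pi> l)\<^sup>2"
  have d: "decreasing_rearr ?b = decreasing_rearr ?a"
    using decreasing_rearr_permute[OF \<pi>, of ?a] by simp
  have "(\<Sum>l\<in>UNIV. ?b $ l) = (\<Sum>l\<in>UNIV. ?a $ l)"
    using sum.reindex_bij_betw[OF \<pi>, of "\<lambda>l. (x $ l)\<^sup>2"] by simp
  then have "majorizes ?a ?b" "majorizes ?b ?a"
    by (auto simp: majorizes_def d)
  then have "g ?a = g ?b"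
    using g(1) by (intro antisym) (auto simp: schur_concave_on_def nonneg_orthant_def)
  then show ?thesis by (simp add: g(2))
qed

lemma orthogonal_transformation_permute:
  fixes \<pi> :: "'n::finite \<Rightarrow> 'n"
  assumes "bij \<pi>"
  shows "orthogonal_transformation (\<lambda>x :: real ^ 'n. \<chi> l. x $ \<pi> l)"
  unfolding orthogonal_transformation_def
proof (intro conjI allI)
  show "linear (\<lambda>x :: real ^ 'n. \<chi> l. x $ \<pi> l)"
    by (rule linearI) (simp_all add: vec_eq_iff)
  show "(\<chi> l. x $ \<pi> l) \<bullet> (\<chi> l. y $ \<pi> l) = x \<bullet> y" for x y :: "real ^ 'n"
    using sum.reindex_bij_betw[OF assms, of "\<lambda>l. x $ l * y $ l"] by (simp add: inner_vec_def)
qed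

lemma orthogonal_transformation_sign:
  fixes \<epsilon> :: "'n::finite \<Rightarrow> real"
  assumes "\<And>l. \<epsilon> l * \<epsilon> l = 1"
  shows "orthogonal_transformation (\<lambda>x :: real ^ 'n. \<chi> l. \<epsilon> l * x $ l)"
  unfolding orthogonal_transformation_def
proof (intro conjI allI)
  show "linear (\<lambda>x :: real ^ 'n. \<chi> l. \<epsilon> l * x $ l)"
    by (rule linearI) (simp_all add: vec_eq_iff algebra_simps)
  have "\<epsilon> l * u * (\<epsilon> l * v) = u * v" for l u v
    using assms[of l] by (metis mult.commute mult.left_commute mult.right_neutral)
  then show "(\<chi> l. \<epsilon> l * x $ l) \<bullet> (\<chi> l. \<epsilon> l * y $ l) = x \<bullet> y" for x y :: "real ^ 'n"
    unfolding inner_vec_def by (intro sum.cong) (simp_all only: vec_lambda_beta inner_real_def)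
qed

lemma gauss_conv_permute:
  fixes f :: "real ^ 'n::finite \<Rightarrow> ennreal"
  assumes f: "schur2_concave f" and \<pi>: "bij \<pi>"
  shows "gauss_conv c s f (\<chi> l. x $ \<pi> l) = gauss_conv c s f x"
  using f schur2_concave_permute[OF f \<pi>]
  by (intro gauss_conv_orthogonal_invariant[OF orthogonal_transformation_permute[OF \<pi>]])
    (auto simp: schur2_concave_def)

lemma gauss_conv_abs:
  fixes f :: "real ^ 'n::finite \<Rightarrow> ennreal"
  assumes f: "schur2_concave f" and xy: "\<And>l. (x $ l)\<^sup>2 = (y $ l)\<^sup>2"
  shows "gauss_conv c s f x = gauss_conv c s f y"
proof -
  define \<epsilon> :: "'n \<Rightarrow> real" where "\<epsilon> l = (if x $ l = y $ l then 1 else - 1)" for l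
  have \<epsilon>: "\<epsilon> l * \<epsilon> l = 1" for l by (simp add: \<epsilon>_def)
  have "x $ l = \<epsilon> l * y $ l" for l
    using xy[of l] by (auto simp: \<epsilon>_def power2_eq_iff)
  then have x: "x = (\<chi> l. \<epsilon> l * y $ l)" by (simp add: vec_eq_iff)
  have "f (\<chi> l. \<epsilon> l * z $ l) = f z" for z
    by (rule schur2_concave_abs[OF f]) (simp add: \<epsilon>_def)
  then show ?thesis
    unfolding x using f
    by (intro gauss_conv_orthogonal_invariant[OF orthogonal_transformation_sign[OF \<epsilon>]])
      (auto simp: schur2_concave_def)
qed

text \<open>A quarter turn of the plane is a coordinate exchange followed by a sign change, and
  \<open>f\<close> is invariant under both.\<close>

lemma gauss_conv_rotate90:
  fixes f :: "real ^ 'n::finite \<Rightarrow> ennreal"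
  assumes f: "schur2_concave f" and ij: "i \<noteq> j"
  shows "gauss_conv c s f (upd2 i j x (- v) u) = gauss_conv c s f (upd2 i j x u v)"
proof -
  have "gauss_conv c s f (upd2 i j x (- v) u) = gauss_conv c s f (upd2 i j x v u)"
    by (rule gauss_conv_abs[OF f]) (simp add: upd2_def)
  also have "upd2 i j x v u = (\<chi> l. upd2 i j x u v $ Transposition.transpose i j l)"
    using ij by (auto simp: upd2_def vec_eq_iff Transposition.transpose_def)
  also have "gauss_conv c s f \<dots> = gauss_conv c s f (upd2 i j x u v)"
    by (rule gauss_conv_permute[OF f]) simp
  finally show ?thesis .
qed


subsection \<open>The planar inequality\<close>

text \<open>The point with coordinates \<open>(P, Q)\<close> in the orthogonal frame \<open>(M, N)\<close>, \<open>(- N, M)\<close> of the \<open>(i, j)\<close>-plane;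
  the frame vectors are not normalized.\<close>

definition frame_point :: "'n \<Rightarrow> 'n \<Rightarrow> real \<Rightarrow> real \<Rightarrow> real ^ 'n::finite \<Rightarrow> real \<Rightarrow> real \<Rightarrow> real ^ 'n" where
  "frame_point i j M N x P Q = upd2 i j x (M * P - N * Q) (N * P + M * Q)"

lemma inner_upd2_0:
  "i \<noteq> j \<Longrightarrow> upd2 i j 0 u v \<bullet> y = u * y $ i + v * y $ j"
proof -
  assume ij: "i \<noteq> j"
  have "(\<Sum>l\<in>UNIV - {i, j}. upd2 i j 0 u v $ l * y $ l) = 0"
    by (intro sum.neutral) (auto simp: upd2_def)
  then show ?thesis
    using ij by (simp add: inner_vec_def sum_split2[OF ij])
qed

text \<open>The reflection fixes the frame vector \<open>(M, N)\<close> and negates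
  \<open>(- N, M)\<close>, the vector along which it is taken.\<close>

lemma householder_frame_point:
  assumes ij: "i \<noteq> j"
  shows "householder (upd2 i j 0 (- N) M) (frame_point i j M N x P Q) = frame_point i j M N x P (- Q)"
proof (cases "M\<^sup>2 + N\<^sup>2 = 0")
  case True
  then have "M = 0" "N = 0" by (auto simp: sum_power2_eq_zero_iff)
  then show ?thesis by (simp add: householder_def frame_point_def vec_eq_iff upd2_def)
next
  case False
  let ?w = "upd2 i j 0 (- N) M"
  have ww: "?w \<bullet> ?w = M\<^sup>2 + N\<^sup>2"
    using ij by (simp add: inner_upd2_0 power2_eq_square)
  have wx: "?w \<bullet> frame_point i j M N x P Q = (M\<^sup>2 + N\<^sup>2) * Q"
    using ij by (simp add: inner_upd2_0 frame_point_def power2_eq_square algebra_simps)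
  have "householder ?w (frame_point i j M N x P Q) = frame_point i j M N x P Q - (2 * Q) *\<^sub>R ?w"
    using nonzero_mult_div_cancel_left[OF False, of "2 * Q"]
    by (simp only: householder_def ww wx mult.left_commute[of 2])
  also have "\<dots> = frame_point i j M N x P (- Q)"
    using ij by (auto simp: vec_eq_iff frame_point_def upd2_def algebra_simps)
  finally show ?thesis .
qed

text \<open>The first factor sees \<open>P\<close> and \<open>Q\<close> only through
  \<open>P\<^sup>2 + Q\<^sup>2\<close>, so it is common to an orbit of quarter turns and to its
  mirror image. The second is the exponential of a linear form in the frame coordinates of
  \<open>y\<close>.\<close>

lemma gauss_kernel_frame_point:
  assumes ij: "i \<noteq> j"
  shows "gauss_kernel c s (frame_point i j M N x P Q) y =
    c * exp (- s * ((\<Sum>l\<in>UNIV - {i, j}. (y $ l - x $ l)\<^sup>2) + (y $ i)\<^sup>2 + (y $ j)\<^sup>2 + (M\<^sup>2 + N\<^sup>2) * (P\<^sup>2 + Q\<^sup>2)))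
      * exp (2 * s * (P * (M * y $ i + N * y $ j) + Q * (M * y $ j - N * y $ i)))"
proof -
  let ?z = "frame_point i j M N x P Q"
  have "(norm (y - ?z))\<^sup>2 = (y $ i - (M * P - N * Q))\<^sup>2 + (y $ j - (N * P + M * Q))\<^sup>2
      + (\<Sum>l\<in>UNIV - {i, j}. (y $ l - ?z $ l)\<^sup>2)"
    using ij by (simp add: power2_norm_eq_inner inner_vec_def power2_eq_square[symmetric]
        sum_split2[OF ij] frame_point_def)
  also have "(\<Sum>l\<in>UNIV - {i, j}. (y $ l - ?z $ l)\<^sup>2) = (\<Sum>l\<in>UNIV - {i, j}. (y $ l - x $ l)\<^sup>2)"
    by (intro sum.cong) (auto simp: frame_point_def)
  finally have norm_eq: "(norm (y - ?z))\<^sup>2 = (y $ i - (M * P - N * Q))\<^sup>2 + (y $ j - (N * P + M * Q))\<^sup>2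
      + (\<Sum>l\<in>UNIV - {i, j}. (y $ l - x $ l)\<^sup>2)" .
  have "- s * (norm (y - ?z))\<^sup>2 =
      - s * ((\<Sum>l\<in>UNIV - {i, j}. (y $ l - x $ l)\<^sup>2) + (y $ i)\<^sup>2 + (y $ j)\<^sup>2 + (M\<^sup>2 + N\<^sup>2) * (P\<^sup>2 + Q\<^sup>2))
      + 2 * s * (P * (M * y $ i + N * y $ j) + Q * (M * y $ j - N * y $ i))"
    unfolding norm_eq
    by algebra
  then show ?thesis
    by (simp add: gauss_kernel_def exp_add[symmetric])
qed

text \<open>Differences of squared coordinates of the two points are, up to sign,
  \<open>4 * ((M * N) * (P * Q))\<close> and
  \<open>(M\<^sup>2 - N\<^sup>2) * (P\<^sup>2 - Q\<^sup>2)\<close>, and the hypotheses give these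
  two a common sign. Hence one coordinate of the point with \<open>- Q\<close>, the
  \<open>i\<close>-th or the \<open>j\<close>-th according to that sign, has a square dominating
  both squares at the other point.\<close>

lemma schur2_concave_frame_point:
  fixes f :: "real ^ 'n::finite \<Rightarrow> ennreal"
  assumes f: "schur2_concave f" and ij: "i \<noteq> j" and MN: "0 \<le> N" "N \<le> M"
    and PQ: "0 \<le> P * Q * (P\<^sup>2 - Q\<^sup>2)"
  shows "f (frame_point i j M N x P (- Q)) \<le> f (frame_point i j M N x P Q)"
proof -
  let ?x = "frame_point i j M N x P (- Q)" and ?y = "frame_point i j M N x P Q"
  have nth: "?x $ i = M * P + N * Q" "?x $ j = N * P - M * Q"
    "?y $ i = M * P - N * Q" "?y $ j = N * P + M * Q"
    using ij by (simp_all add: frame_point_def)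
  have rest: "(?x $ l)\<^sup>2 = (?y $ l)\<^sup>2" if "l \<noteq> i" "l \<noteq> j" for l
    using that by (simp add: frame_point_def)
  have tot: "(?x $ i)\<^sup>2 + (?x $ j)\<^sup>2 = (?y $ i)\<^sup>2 + (?y $ j)\<^sup>2"
    unfolding nth by (simp add: power2_eq_square algebra_simps)
  have MN2: "0 \<le> M\<^sup>2 - N\<^sup>2" "0 \<le> M * N" using MN by (auto intro: power_mono)
  have d: "(?x $ i)\<^sup>2 - (?y $ i)\<^sup>2 = 4 * ((M * N) * (P * Q))"
    "(?x $ i)\<^sup>2 - (?y $ j)\<^sup>2 = (M\<^sup>2 - N\<^sup>2) * (P\<^sup>2 - Q\<^sup>2)"
    "(?x $ j)\<^sup>2 - (?y $ j)\<^sup>2 = - (4 * ((M * N) * (P * Q)))"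
    "(?x $ j)\<^sup>2 - (?y $ i)\<^sup>2 = - ((M\<^sup>2 - N\<^sup>2) * (P\<^sup>2 - Q\<^sup>2))"
    unfolding nth by (simp_all add: power2_eq_square algebra_simps)
  consider "0 \<le> P * Q" "0 \<le> P\<^sup>2 - Q\<^sup>2" | "P * Q \<le> 0" "P\<^sup>2 - Q\<^sup>2 \<le> 0"
    using PQ by (auto simp: zero_le_mult_iff)
  then show ?thesis
  proof cases
    case 1
    then have "0 \<le> (M * N) * (P * Q)" "0 \<le> (M\<^sup>2 - N\<^sup>2) * (P\<^sup>2 - Q\<^sup>2)"
      using MN2 by (simp_all only: mult_nonneg_nonneg)
    then show ?thesis
      using d by (intro schur2_concave_transfer[OF f ij tot _ _ rest]) auto
  next
    case 2
    then have "(M * N) * (P * Q) \<le> 0" "(M\<^sup>2 - N\<^sup>2) * (P\<^sup>2 - Q\<^sup>2) \<le> 0"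
      using MN2 by (simp_all only: mult_nonneg_nonpos)
    then show ?thesis
      using d tot by (intro schur2_concave_transfer[OF f ij[symmetric] _ _ _ rest]) auto
  qed
qed

section \<open>Comparison and equality for extended nonnegative reals\<close>

text \<open>Both sides contain \<open>A * K2 + B * K2\<close>, which leaves \<open>B * d\<close>
  against \<open>A * d\<close> with \<open>d = K1 - K2\<close>. Finiteness permits the cancellation
  in the equality case.\<close>

lemma ennreal_rearrangement:
  fixes A B :: ennreal
  assumes AB: "B \<le> A" and K: "0 \<le> K2" "K2 \<le> K1"
  shows "A * ennreal K2 + B * ennreal K1 \<le> A * ennreal K1 + B * ennreal K2" (is "?L \<le> ?R")
    and "A * ennreal K2 + B * ennreal K1 = A * ennreal K1 + B * ennreal K2 \<Longrightarrow>
      A * ennreal K1 + B * ennreal K2 \<noteq> \<infinity> \<Longrightarrow> K2 < K1 \<Longrightarrow> A = B"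
proof -
  define d where "d = K1 - K2"
  have K1: "ennreal K1 = ennreal K2 + ennreal d"
    using K by (simp add: d_def ennreal_plus[symmetric] del: ennreal_plus)
  have L: "?L = (A * ennreal K2 + B * ennreal K2) + B * ennreal d"
    and R: "?R = (A * ennreal K2 + B * ennreal K2) + A * ennreal d"
    by (simp_all add: K1 distrib_left add_ac)
  show "?L \<le> ?R"
    unfolding L R using AB by (intro add_left_mono mult_right_mono) auto
  show "A = B" if "?L = ?R" "?R \<noteq> \<infinity>" "K2 < K1"
  proof -
    have "B * ennreal d = A * ennreal d"
      using that(1,2) unfolding L R by (subst (asm) ennreal_add_left_cancel) auto
    moreover have "ennreal d \<noteq> 0" "ennreal d \<noteq> top"
      using that(3) by (auto simp: d_def)
    ultimately show ?thesis
      using ennreal_mult_cancel_left[of "ennreal d" B A] by (auto simp: mult.commute)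
  qed
qed

text \<open>The integral of \<open>u - v\<close> vanishes. Finiteness almost everywhere is recorded
  as well, because the equality case of \<open>ennreal_rearrangement\<close> calls for it.\<close>

lemma nn_integral_eq_imp_AE_eq:
  assumes [measurable]: "u \<in> borel_measurable M" "v \<in> borel_measurable M"
    and le: "\<And>x. v x \<le> u x"
    and eq: "(\<integral>\<^sup>+ x. u x \<partial>M) = (\<integral>\<^sup>+ x. v x \<partial>M)" and fin: "(\<integral>\<^sup>+ x. u x \<partial>M) \<noteq> \<infinity>"
  shows "AE x in M. u x = v x \<and> u x \<noteq> \<infinity>"
proof -
  have "(\<integral>\<^sup>+ x. u x - v x \<partial>M) = 0"
    using le eq fin by (subst nn_integral_diff) auto
  then have "AE x in M. u x - v x = 0"
    by (subst (asm) nn_integral_0_iff_AE) auto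
  moreover have "AE x in M. u x \<noteq> \<infinity>"
    using fin by (intro nn_integral_PInf_AE) auto
  ultimately show ?thesis
  proof eventually_elim
    case (elim x)
    then show ?case using le[of x] by (auto simp: diff_eq_0_iff_ennreal intro: antisym)
  qed
qed

lemma AE_inner_nonzero:
  fixes w :: "'a::euclidean_space"
  assumes "w \<noteq> 0"
  shows "AE y in lebesgue. w \<bullet> y \<noteq> 0"
proof -
  have "negligible {y. w \<bullet> y = 0}" using assms by (intro negligible_hyperplane) auto
  then have "{y. w \<bullet> y = 0} \<in> null_sets lebesgue" by (simp add: negligible_iff_null_sets)
  from AE_not_in[OF this] show ?thesis by simp
qed

text \<open>The compared points, with frame coordinates \<open>(1, - k)\<close> and
  \<open>(1, k)\<close>, are mirror images in the line along \<open>(M, N)\<close>; the conditions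
  on \<open>M\<close> and \<open>N\<close> place that line between the \<open>i\<close>-axis and the
  diagonal.\<close>

lemma gauss_conv_frame_point:
  fixes f :: "real ^ 'n::finite \<Rightarrow> ennreal"
  assumes f: "schur2_concave f" and ij: "i \<noteq> j" and MN: "0 \<le> N" "N \<le> M" "0 < M"
    and k: "0 < k" "k < 1" and c: "0 < c" and s: "0 < s"
  shows "gauss_conv c s f (frame_point i j M N x 1 (- k)) \<le> gauss_conv c s f (frame_point i j M N x 1 k)"
    and "gauss_conv c s f (frame_point i j M N x 1 (- k)) = gauss_conv c s f (frame_point i j M N x 1 k) \<Longrightarrow>
      gauss_conv c s f (frame_point i j M N x 1 k) \<noteq> \<infinity> \<Longrightarrow>
      AE y in lebesgue. f (householder (upd2 i j 0 (- N) M) y) = f y"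
proof -
  let ?F = "gauss_conv c s f"
  define R where "R = householder (upd2 i j 0 (- N) M)"
  define pt where "pt P Q = frame_point i j M N x P Q" for P Q
  define K where "K P Q y = gauss_kernel c s (pt P Q) y" for P Q y
  have R: "orthogonal_transformation R" unfolding R_def by (rule orthogonal_transformation_refl)
  have fm [measurable]: "f \<in> borel_measurable lebesgue" using f by (simp add: schur2_concave_def)
  have fR [measurable]: "(\<lambda>y. f (R y)) \<in> borel_measurable lebesgue"
    using measurable_comp[OF lebesgue_measurable_orthogonal[OF R] fm] by (simp add: o_def)
  have [measurable]: "(\<lambda>y. ennreal (K P Q y)) \<in> borel_measurable lebesgue" for P Q
    unfolding K_def by measurable
  have K_pos: "0 < K P Q y" for P Q y using c by (simp add: K_def gauss_kernel_def)
  \<comment> \<open>In frame coordinates the quarter turn takes \<open>(P, Q)\<close> to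
    \<open>(- Q, P)\<close>.\<close>
  have rot: "?F (pt (- Q) P) = ?F (pt P Q)" for P Q
  proof -
    have "pt (- Q) P = upd2 i j x (- (N * P + M * Q)) (M * P - N * Q)"
      by (simp add: pt_def frame_point_def algebra_simps)
    then show ?thesis
      using gauss_conv_rotate90[OF f ij, of c s x "N * P + M * Q" "M * P - N * Q"]
      by (simp add: pt_def frame_point_def)
  qed
  have F1: "(\<integral>\<^sup>+ y. f y * ennreal (K P Q y) \<partial>lebesgue) = ?F (pt P Q)" for P Q
    by (simp add: gauss_conv_def K_def)
  have F2: "(\<integral>\<^sup>+ y. f (R y) * ennreal (K P Q y) \<partial>lebesgue) = ?F (pt P (- Q))" for P Q
    using gauss_conv_orthogonal[OF R fm, of c s "pt P Q"] householder_frame_point[OF ij, of N M x P Q]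
    by (simp add: K_def pt_def R_def)
  have orbit: "?F (pt (- k) 1) = ?F (pt 1 k)" "?F (pt (- 1) (- k)) = ?F (pt 1 k)" "?F (pt k (- 1)) = ?F (pt 1 k)"
    "?F (pt (- k) (- 1)) = ?F (pt 1 (- k))" "?F (pt (- 1) k) = ?F (pt 1 (- k))" "?F (pt k 1) = ?F (pt 1 (- k))"
    using rot[of k 1] rot[of 1 "- k"] rot[of "- k" "- 1"] rot[of "- 1" k]
      rot[of "- k" 1] rot[of 1 k] rot[of k "- 1"] rot[of "- 1" "- k"] by simp_all
  \<comment> \<open>\<open>K1\<close> sums the kernels over the four quarter turns of
    \<open>(1, k)\<close>, and \<open>K2\<close> over those of the mirror image
    \<open>(1, - k)\<close>.\<close>
  define K1 where "K1 y = K 1 k y + K (- k) 1 y + K (- 1) (- k) y + K k (- 1) y" for y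
  define K2 where "K2 y = K 1 (- k) y + K (- k) (- 1) y + K (- 1) k y + K k 1 y" for y
  have K1_pos: "0 < K1 y" and K2_pos: "0 < K2 y" for y
    using K_pos by (simp_all add: K1_def K2_def add_pos_pos)
  have K1_e: "ennreal (K1 y) = ennreal (K 1 k y) + ennreal (K (- k) 1 y) + ennreal (K (- 1) (- k) y) + ennreal (K k (- 1) y)"
    and K2_e: "ennreal (K2 y) = ennreal (K 1 (- k) y) + ennreal (K (- k) (- 1) y) + ennreal (K (- 1) k y) + ennreal (K k 1 y)" for y
    using K_pos by (simp_all add: K1_def K2_def less_imp_le)
  \<comment> \<open>\<open>V\<close> is \<open>U\<close> with the weights exchanged. Expanded, each
    has eight terms with equal integrals, so the integrals are eight times the convolution at the
    two points, and a pointwise comparison of \<open>V\<close> and \<open>U\<close>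
    suffices.\<close>
  define U where "U y = f y * ennreal (K1 y) + f (R y) * ennreal (K2 y)" for y
  define V where "V y = f y * ennreal (K2 y) + f (R y) * ennreal (K1 y)" for y
  have Um [measurable]: "U \<in> borel_measurable lebesgue" and Vm [measurable]: "V \<in> borel_measurable lebesgue"
    unfolding U_def V_def K1_e K2_e by measurable
  have eight: "8 * z = z + z + z + z + (z + z + z + z)" for z :: ennreal
  proof -
    have "8 * z = 2 * (2 * (2 * z))" by (simp add: mult.assoc[symmetric])
    then show ?thesis by (simp only: mult_2 add.assoc)
  qed
  have U: "(\<integral>\<^sup>+ y. U y \<partial>lebesgue) = 8 * ?F (pt 1 k)"
    unfolding U_def K1_e K2_e distrib_left
    by (simp add: nn_integral_add F1 F2 orbit eight add.assoc)
  have V: "(\<integral>\<^sup>+ y. V y \<partial>lebesgue) = 8 * ?F (pt 1 (- k))"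
    unfolding V_def K1_e K2_e distrib_left
    by (simp add: nn_integral_add F1 F2 orbit eight add.assoc)
  \<comment> \<open>\<open>p y\<close> and \<open>q y\<close> are the frame coordinates of
    \<open>y\<close> up to the factor \<open>M\<^sup>2 + N\<^sup>2\<close>. The sign of
    \<open>T y\<close> decides both the order of \<open>f y\<close> and \<open>f (R y)\<close> and
    that of \<open>K1 y\<close> and \<open>K2 y\<close>.\<close>
  define p where "p y = M * y $ i + N * y $ j" for y :: "real ^ 'n"
  define q where "q y = M * y $ j - N * y $ i" for y :: "real ^ 'n"
  define T where "T y = p y * q y * ((p y)\<^sup>2 - (q y)\<^sup>2)" for y
  have D: "0 < M\<^sup>2 + N\<^sup>2" using MN by (simp add: sum_power2_gt_zero_iff)
  have y_pt: "y = frame_point i j M N y (p y / (M\<^sup>2 + N\<^sup>2)) (q y / (M\<^sup>2 + N\<^sup>2))" for y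
  proof -
    have "M * (p y / (M\<^sup>2 + N\<^sup>2)) - N * (q y / (M\<^sup>2 + N\<^sup>2)) = ((M\<^sup>2 + N\<^sup>2) * y $ i) / (M\<^sup>2 + N\<^sup>2)"
      "N * (p y / (M\<^sup>2 + N\<^sup>2)) + M * (q y / (M\<^sup>2 + N\<^sup>2)) = ((M\<^sup>2 + N\<^sup>2) * y $ j) / (M\<^sup>2 + N\<^sup>2)"
      unfolding times_divide_eq_right diff_divide_distrib[symmetric] add_divide_distrib[symmetric]
      by (simp_all add: p_def q_def power2_eq_square algebra_simps)
    then show ?thesis using MN(3) by (simp add: frame_point_def)
  qed
  have Ry: "R y = frame_point i j M N y (p y / (M\<^sup>2 + N\<^sup>2)) (- (q y / (M\<^sup>2 + N\<^sup>2)))" for y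
    using householder_frame_point[OF ij, of N M y "p y / (M\<^sup>2 + N\<^sup>2)" "q y / (M\<^sup>2 + N\<^sup>2)"] y_pt[of y]
    by (simp add: R_def)
  have T_scaled: "(p y / D) * (q y / D) * ((p y / D)\<^sup>2 - (q y / D)\<^sup>2) = T y / D ^ 4" for y D
    by (simp add: T_def power_divide diff_divide_distrib[symmetric] power2_eq_square power4_eq_xxxx)
  have fR_le: "f (R y) \<le> f y" if "0 \<le> T y" for y
  proof -
    have "f (frame_point i j M N y (p y / (M\<^sup>2 + N\<^sup>2)) (- (q y / (M\<^sup>2 + N\<^sup>2))))
      \<le> f (frame_point i j M N y (p y / (M\<^sup>2 + N\<^sup>2)) (q y / (M\<^sup>2 + N\<^sup>2)))"
      using that by (intro schur2_concave_frame_point[OF f ij MN(1,2)]) (simp only: T_scaled, simp)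
    then show ?thesis using y_pt[of y] Ry[of y] by simp
  qed
  have fR_ge: "f y \<le> f (R y)" if "T y \<le> 0" for y
  proof -
    have T_neg: "(p y / D) * (- (q y / D)) * ((p y / D)\<^sup>2 - (- (q y / D))\<^sup>2) = - (T y / D ^ 4)" for D
      using T_scaled[of y D] by simp
    have "f (frame_point i j M N y (p y / (M\<^sup>2 + N\<^sup>2)) (- (- (q y / (M\<^sup>2 + N\<^sup>2)))))
      \<le> f (frame_point i j M N y (p y / (M\<^sup>2 + N\<^sup>2)) (- (q y / (M\<^sup>2 + N\<^sup>2))))"
      using that by (intro schur2_concave_frame_point[OF f ij MN(1,2)])
        (simp only: T_neg, simp add: divide_nonpos_nonneg)
    then show ?thesis using y_pt[of y] Ry[of y] by simp
  qed
  have K_sgn: "sgn (K1 y - K2 y) = sgn (T y)" for y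
  proof -
    define C where "C = c * exp (- s * ((\<Sum>l\<in>UNIV - {i, j}. (y $ l - x $ l)\<^sup>2) + (y $ i)\<^sup>2 + (y $ j)\<^sup>2 + (M\<^sup>2 + N\<^sup>2) * (1 + k\<^sup>2)))"
    define a b where "a = 2 * s * p y" and "b = 2 * s * q y"
    have C: "0 < C" using c by (simp add: C_def)
    have K: "K P Q y = C * exp (P * a + Q * b)" if "P\<^sup>2 + Q\<^sup>2 = 1 + k\<^sup>2" for P Q
      unfolding K_def pt_def gauss_kernel_frame_point[OF ij] that C_def[symmetric]
      by (simp add: a_def b_def p_def q_def algebra_simps)
    \<comment> \<open>Opposite points of an orbit pair up to hyperbolic cosines, and the addition
      formula turns their differences into products of hyperbolic sines.\<close>
    have "K1 y - K2 y = (4 * C) * (sinh a * sinh (k * b) - sinh (k * a) * sinh b)"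
      by (simp add: K1_def K2_def K sinh_field_def exp_add exp_minus exp_diff algebra_simps divide_simps)
    then have "sgn (K1 y - K2 y) = sgn (sinh a * sinh (k * b) - sinh (k * a) * sinh b)"
      using C by (simp only: sgn_mult) simp
    also have "\<dots> = sgn (a * b * (a\<^sup>2 - b\<^sup>2))" by (rule sinh_mult_sgn[OF k])
    also have "a * b * (a\<^sup>2 - b\<^sup>2) = (2 * s) ^ 4 * T y"
      by (simp add: a_def b_def T_def power2_eq_square power4_eq_xxxx algebra_simps)
    also have "sgn \<dots> = sgn (T y)" using s by (simp add: sgn_mult)
    finally show ?thesis .
  qed
  have VU: "V y \<le> U y" for y
  proof (cases "0 \<le> T y")
    case True
    then have "K2 y \<le> K1 y" using K_sgn[of y] by (auto simp: sgn_if split: if_splits)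
    then show ?thesis unfolding U_def V_def
      using fR_le[OF True] K2_pos[of y] by (intro ennreal_rearrangement(1)) auto
  next
    case False
    then have "T y \<le> 0" "K1 y \<le> K2 y" using K_sgn[of y] by (auto simp: sgn_if split: if_splits)
    then show ?thesis unfolding U_def V_def
      using fR_ge[of y] K1_pos[of y] ennreal_rearrangement(1)[of "f y" "f (R y)" "K1 y" "K2 y"]
      by (simp add: add.commute)
  qed
  have "8 * ?F (pt 1 (- k)) \<le> 8 * ?F (pt 1 k)"
    unfolding U[symmetric] V[symmetric] by (intro nn_integral_mono VU)
  then show "?F (frame_point i j M N x 1 (- k)) \<le> ?F (frame_point i j M N x 1 k)"
    by (simp add: pt_def ennreal_mult_le_mult_iff)
  show "AE y in lebesgue. f (householder (upd2 i j 0 (- N) M) y) = f y"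
    if eq: "?F (frame_point i j M N x 1 (- k)) = ?F (frame_point i j M N x 1 k)"
      and fin: "?F (frame_point i j M N x 1 k) \<noteq> \<infinity>"
  proof -
    have "AE y in lebesgue. U y = V y \<and> U y \<noteq> \<infinity>"
      by (rule nn_integral_eq_imp_AE_eq[OF Um Vm VU])
        (use eq fin in \<open>auto simp: U V pt_def ennreal_mult_eq_top_iff\<close>)
    \<comment> \<open>\<open>T\<close> vanishes only on the four hyperplanes \<open>p = 0\<close>,
      \<open>q = 0\<close>, \<open>p = q\<close> and \<open>p = - q\<close>.\<close>
    moreover have "AE y in lebesgue. T y \<noteq> 0"
    proof -
      have "p y = upd2 i j 0 M N \<bullet> y" "q y = upd2 i j 0 (- N) M \<bullet> y"
        "p y - q y = upd2 i j 0 (M + N) (N - M) \<bullet> y" "p y + q y = upd2 i j 0 (M - N) (M + N) \<bullet> y" for y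
        by (simp_all add: inner_upd2_0[OF ij] p_def q_def algebra_simps)
      moreover have "upd2 i j 0 u v \<noteq> 0" if "u \<noteq> 0 \<or> v \<noteq> 0" for u v
        using that ij by (auto simp: vec_eq_iff upd2_def)
      ultimately have "AE y in lebesgue. p y \<noteq> 0" "AE y in lebesgue. q y \<noteq> 0"
        "AE y in lebesgue. p y - q y \<noteq> 0" "AE y in lebesgue. p y + q y \<noteq> 0"
        using MN by (auto intro!: AE_inner_nonzero)
      then show ?thesis
      proof eventually_elim
        case (elim y)
        have "T y = p y * q y * ((p y - q y) * (p y + q y))"
          by (simp add: T_def power2_eq_square algebra_simps)
        then show ?case using elim by simp
      qed
    qed
    ultimately show ?thesis
    proof eventually_elim
      case (elim y)
      show ?case
      proof (cases "0 < T y")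
        case True
        then have "K2 y < K1 y" using K_sgn[of y] by (auto simp: sgn_if split: if_splits)
        then show ?thesis
          using ennreal_rearrangement(2)[of "f (R y)" "f y" "K2 y" "K1 y"] elim fR_le[of y] True K2_pos[of y]
          by (simp add: U_def V_def R_def)
      next
        case False
        then have "T y < 0" "K1 y < K2 y" using elim K_sgn[of y] by (auto simp: sgn_if split: if_splits)
        then show ?thesis
          using ennreal_rearrangement(2)[of "f y" "f (R y)" "K1 y" "K2 y"] elim fR_ge[of y] K1_pos[of y]
          by (simp add: U_def V_def R_def add.commute)
      qed
    qed
  qed
qed


subsection \<open>Invariance under reflections\<close>

text \<open>The points at angles \<open>t1\<close> and \<open>t2\<close> are mirror images in the
  line at the mean angle \<mu>. With \<epsilon> half the difference, a frame of length
  \<open>r * cos \<epsilon>\<close> at angle \<mu> gives them the coordinates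
  \<open>(1, - tan \<epsilon>)\<close> and \<open>(1, tan \<epsilon>)\<close>. The bounds
  \<open>0\<close> and \<open>pi / 4\<close> on the angles supply the conditions on the frame and
  \<open>tan \<epsilon> < 1\<close>.\<close>

lemma gauss_conv_arc_aux:
  fixes f :: "real ^ 'n::finite \<Rightarrow> ennreal" and x :: "real ^ 'n"
  assumes f: "schur2_concave f" and ij: "i \<noteq> j" and c: "0 < c" and s: "0 < s" and r: "0 < r"
    and t: "0 \<le> t1" "t1 < t2" "t2 \<le> pi / 4"
  defines F: "F \<equiv> \<lambda>t. gauss_conv c s f (upd2 i j x (r * cos t) (r * sin t))"
  shows "F t1 \<le> F t2"
    and "F t1 = F t2 \<Longrightarrow> F t2 \<noteq> \<infinity> \<Longrightarrow>
      AE y in lebesgue. f (householder (upd2 i j 0 (- sin ((t1 + t2) / 2)) (cos ((t1 + t2) / 2))) y) = f y"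
proof -
  define \<mu> where "\<mu> = (t1 + t2) / 2"
  define \<epsilon> where "\<epsilon> = (t2 - t1) / 2"
  define \<rho> where "\<rho> = r * cos \<epsilon>"
  have \<epsilon>: "0 < \<epsilon>" "\<epsilon> < pi / 4" using t by (auto simp: \<epsilon>_def field_simps)
  have \<mu>: "0 < \<mu>" "\<mu> < pi / 4" using t by (auto simp: \<mu>_def field_simps)
  have cos_\<epsilon>: "0 < cos \<epsilon>" using \<epsilon> by (intro cos_gt_zero) auto
  have \<rho>: "0 < \<rho>" using r cos_\<epsilon> by (simp add: \<rho>_def)
  have "sin \<mu> \<le> sin (pi / 4)" using \<mu> by (intro sin_monotone_2pi_le) auto
  also have "sin (pi / 4) = cos (pi / 4)" by (simp add: sin_45 cos_45)
  also have "\<dots> \<le> cos \<mu>" using \<mu> by (intro cos_monotone_0_pi_le) auto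
  finally have "sin \<mu> \<le> cos \<mu>" .
  moreover have "0 < sin \<mu>" "0 < cos \<mu>"
    using \<mu> by (intro sin_gt_zero; simp) (use \<mu> in \<open>intro cos_gt_zero; simp\<close>)
  ultimately have MN: "0 \<le> \<rho> * sin \<mu>" "\<rho> * sin \<mu> \<le> \<rho> * cos \<mu>" "0 < \<rho> * cos \<mu>"
    using \<rho> by auto
  have "tan \<epsilon> < tan (pi / 4)" using \<epsilon> by (intro tan_monotone) auto
  then have k: "0 < tan \<epsilon>" "tan \<epsilon> < 1" using \<epsilon> by (auto simp: tan_45 intro!: tan_gt_zero)
  have t12: "t2 = \<mu> + \<epsilon>" "t1 = \<mu> - \<epsilon>" by (simp_all add: \<mu>_def \<epsilon>_def field_simps)
  have p: "\<rho> * cos \<mu> * 1 - \<rho> * sin \<mu> * tan \<epsilon> = r * cos t2"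
    "\<rho> * sin \<mu> * 1 + \<rho> * cos \<mu> * tan \<epsilon> = r * sin t2"
    "\<rho> * cos \<mu> * 1 - \<rho> * sin \<mu> * (- tan \<epsilon>) = r * cos t1"
    "\<rho> * sin \<mu> * 1 + \<rho> * cos \<mu> * (- tan \<epsilon>) = r * sin t1"
  proof -
    have sin_\<epsilon>: "sin \<epsilon> = cos \<epsilon> * tan \<epsilon>" using cos_\<epsilon> by (simp add: tan_def)
    show "\<rho> * cos \<mu> * 1 - \<rho> * sin \<mu> * tan \<epsilon> = r * cos t2"
      "\<rho> * sin \<mu> * 1 + \<rho> * cos \<mu> * tan \<epsilon> = r * sin t2"
      "\<rho> * cos \<mu> * 1 - \<rho> * sin \<mu> * (- tan \<epsilon>) = r * cos t1"
      "\<rho> * sin \<mu> * 1 + \<rho> * cos \<mu> * (- tan \<epsilon>) = r * sin t1"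
      unfolding t12 cos_add sin_add cos_diff sin_diff \<rho>_def sin_\<epsilon> by (simp_all add: algebra_simps)
  qed
  have w: "upd2 i j 0 (- (\<rho> * sin \<mu>)) (\<rho> * cos \<mu>) = \<rho> *\<^sub>R upd2 i j 0 (- sin \<mu>) (cos \<mu>)"
    by (simp add: vec_eq_iff upd2_def)
  note * = gauss_conv_frame_point[OF f ij MN k c s, of x, unfolded frame_point_def p]
  show "F t1 \<le> F t2" unfolding F by (rule *(1))
  show "AE y in lebesgue. f (householder (upd2 i j 0 (- sin ((t1 + t2) / 2)) (cos ((t1 + t2) / 2))) y) = f y"
    if "F t1 = F t2" "F t2 \<noteq> \<infinity>"
    using *(2) that \<rho> unfolding F w by (simp add: householder_scaleR \<mu>_def)
qed

lemma gauss_conv_arc_mono: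
  fixes f :: "real ^ 'n::finite \<Rightarrow> ennreal"
  assumes "schur2_concave f" "i \<noteq> j" "0 < c" "0 < s" "0 < r" "0 \<le> t1" "t1 \<le> t2" "t2 \<le> pi / 4"
  shows "gauss_conv c s f (upd2 i j x (r * cos t1) (r * sin t1))
    \<le> gauss_conv c s f (upd2 i j x (r * cos t2) (r * sin t2))"
  using gauss_conv_arc_aux(1)[OF assms(1-6), of t2 x] assms(7,8) by (cases "t1 = t2") auto

text \<open>Stated almost everywhere, since equality of integrals controls \<open>f\<close> only up
  to null sets.\<close>

definition reflection_invariant :: "('a::euclidean_space \<Rightarrow> ennreal) \<Rightarrow> 'a \<Rightarrow> bool" where
  "reflection_invariant f w \<longleftrightarrow> (AE y in lebesgue. f (householder w y) = f y)"

text \<open>Monotonicity along the arc spreads the equality to \<open>t1\<close> and every \<tau>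
  between \<open>t1\<close> and \<open>t2\<close>. Choosing \<tau> so that \<mu> is the mean angle
  yields an interval of mirror lines instead of a single one.\<close>

lemma gauss_conv_arc_eq:
  fixes f :: "real ^ 'n::finite \<Rightarrow> ennreal"
  assumes f: "schur2_concave f" and ij: "i \<noteq> j" and cs: "0 < c" "0 < s" and r: "0 < r"
    and t: "0 \<le> t1" "t1 < t2" "t2 \<le> pi / 4"
    and eq: "gauss_conv c s f (upd2 i j x (r * cos t1) (r * sin t1))
      = gauss_conv c s f (upd2 i j x (r * cos t2) (r * sin t2))"
    and fin: "gauss_conv c s f (upd2 i j x (r * cos t2) (r * sin t2)) \<noteq> \<infinity>"
    and \<mu>: "t1 < \<mu>" "\<mu> \<le> (t1 + t2) / 2"
  shows "reflection_invariant f (upd2 i j 0 (- sin \<mu>) (cos \<mu>))"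
proof -
  let ?F = "\<lambda>t. gauss_conv c s f (upd2 i j x (r * cos t) (r * sin t))"
  define \<tau> where "\<tau> = 2 * \<mu> - t1"
  have \<tau>: "t1 < \<tau>" "\<tau> \<le> t2" "(t1 + \<tau>) / 2 = \<mu>" using \<mu> by (auto simp: \<tau>_def)
  have "?F t1 \<le> ?F \<tau>" "?F \<tau> \<le> ?F t2"
    using \<tau> t by (auto intro!: gauss_conv_arc_mono[OF f ij cs r])
  then have "?F t1 = ?F \<tau>" "?F \<tau> \<noteq> \<infinity>" using eq fin by auto
  then show ?thesis
    using gauss_conv_arc_aux(2)[OF f ij cs r t(1) \<tau>(1), of x] \<tau> t
    by (simp add: reflection_invariant_def)
qed

section \<open>Generating all directions of invariance\<close>

lemma householder_orthogonal:
  assumes "orthogonal_transformation Q"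
  shows "householder (Q w) (Q y) = Q (householder w y)"
  using assms by (simp add: householder_def orthogonal_transformation_def linear_diff linear_scale)

lemma reflection_invariant_scaleR:
  "reflection_invariant f w \<Longrightarrow> reflection_invariant f (k *\<^sub>R w)"
  by (cases "k = 0") (simp_all add: reflection_invariant_def householder_scaleR, simp add: householder_def)

text \<open>Conjugating the reflection along \<open>w\<close> by \<open>Q\<close> gives the
  reflection along \<open>Q w\<close>; the exceptional sets stay null because orthogonal maps
  preserve null sets.\<close>

lemma reflection_invariant_orthogonal:
  fixes f :: "real ^ 'n::finite \<Rightarrow> ennreal" and Q :: "real ^ 'n \<Rightarrow> real ^ 'n"
  assumes Q: "orthogonal_transformation Q" and fQ: "AE y in lebesgue. f (Q y) = f y"
    and w: "reflection_invariant f w"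
  shows "reflection_invariant f (Q w)"
proof -
  have "AE z in lebesgue. f (Q (householder w z)) = f (householder w z)"
    using AE_orthogonal[OF orthogonal_transformation_refl fQ] .
  with w fQ have "AE z in lebesgue. f (householder (Q w) (Q z)) = f (Q z)"
    unfolding reflection_invariant_def householder_orthogonal[OF Q]
    by eventually_elim simp
  from AE_orthogonal[OF orthogonal_transformation_inv[OF Q] this]
  show ?thesis
    using orthogonal_transformation_surj[OF Q] by (simp add: reflection_invariant_def surj_f_inv_f)
qed

text \<open>The case \<open>Q = householder v\<close>: the closure property from which the next two
  lemmas generate all directions.\<close>

lemma reflection_invariant_refl:
  fixes f :: "real ^ 'n::finite \<Rightarrow> ennreal"
  assumes "reflection_invariant f v" "reflection_invariant f w"
  shows "reflection_invariant f (householder v w)"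
  using reflection_invariant_orthogonal[OF orthogonal_transformation_refl _ assms(2)] assms(1)
  by (simp add: reflection_invariant_def)

text \<open>Up to sign, reflecting the normal at angle \<nu> along the normal at angle \<mu> gives
  the normal at angle \<open>2 * \<mu> - \<nu>\<close>. Reflecting an interval of invariant angles
  in its right endpoint thus doubles it; iteration and periodicity reach every angle.\<close>

lemma reflection_invariant_plane:
  fixes f :: "real ^ 'n::finite \<Rightarrow> ennreal"
  assumes ij: "i \<noteq> j" and "A < B"
    and AB: "\<And>\<mu>. A \<le> \<mu> \<Longrightarrow> \<mu> \<le> B \<Longrightarrow> reflection_invariant f (upd2 i j 0 (- sin \<mu>) (cos \<mu>))"
  shows "reflection_invariant f (upd2 i j 0 u v)"
proof -
  let ?w = "\<lambda>\<mu>. upd2 i j 0 (- sin \<mu>) (cos \<mu>) :: real ^ 'n"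
  have householder_w: "householder (?w \<mu>) (?w \<nu>) = (- 1) *\<^sub>R ?w (2 * \<mu> - \<nu>)" for \<mu> \<nu>
  proof -
    have ip: "?w \<mu> \<bullet> ?w \<nu> = cos (\<mu> - \<nu>)" "?w \<mu> \<bullet> ?w \<mu> = 1"
      using ij by (simp_all add: inner_upd2_0 cos_diff power2_eq_square[symmetric])
    have trig: "2 * cos (\<mu> - \<nu>) * sin \<mu> = sin \<nu> + sin (2 * \<mu> - \<nu>)"
      "2 * cos (\<mu> - \<nu>) * cos \<mu> = cos \<nu> + cos (2 * \<mu> - \<nu>)"
    proof -
      have "2 * cos b * sin a = sin (a - b) + sin (a + b)" "2 * cos b * cos a = cos (a - b) + cos (a + b)"
        for a b :: real
        by (simp_all add: sin_add sin_diff cos_add cos_diff)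
      from this[where a=\<mu> and b="\<mu> - \<nu>"]
      show "2 * cos (\<mu> - \<nu>) * sin \<mu> = sin \<nu> + sin (2 * \<mu> - \<nu>)"
        "2 * cos (\<mu> - \<nu>) * cos \<mu> = cos \<nu> + cos (2 * \<mu> - \<nu>)"
        by (simp_all only: diff_diff_eq2 add_diff_cancel_left' mult_2 add_diff_eq)
    qed
    have "householder (?w \<mu>) (?w \<nu>) = ?w \<nu> - (2 * cos (\<mu> - \<nu>)) *\<^sub>R ?w \<mu>"
      by (simp only: householder_def ip div_by_1)
    also have "\<dots> = upd2 i j 0 (- sin \<nu> + 2 * cos (\<mu> - \<nu>) * sin \<mu>) (cos \<nu> - 2 * cos (\<mu> - \<nu>) * cos \<mu>)"
      by (simp add: vec_eq_iff upd2_def)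
    also have "\<dots> = (- 1) *\<^sub>R ?w (2 * \<mu> - \<nu>)"
      unfolding trig by (simp add: vec_eq_iff upd2_def)
    finally show ?thesis .
  qed
  have householder_S: "reflection_invariant f (?w (2 * \<mu> - \<nu>))"
    if "reflection_invariant f (?w \<mu>)" "reflection_invariant f (?w \<nu>)" for \<mu> \<nu>
    using reflection_invariant_scaleR[OF reflection_invariant_refl[OF that], of "- 1"]
    by (simp add: householder_w)
  have double: "\<forall>\<mu>. A \<le> \<mu> \<and> \<mu> \<le> A + 2 ^ n * (B - A) \<longrightarrow> reflection_invariant f (?w \<mu>)" for n :: nat
  proof (induction n)
    case 0
    then show ?case using AB by auto
  next
    case (Suc n)
    let ?L = "A + 2 ^ n * (B - A)"
    have L: "A \<le> ?L" using \<open>A < B\<close> by simp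
    show ?case
    proof (intro allI impI)
      fix \<mu> assume \<mu>: "A \<le> \<mu> \<and> \<mu> \<le> A + 2 ^ Suc n * (B - A)"
      show "reflection_invariant f (?w \<mu>)"
      proof (cases "\<mu> \<le> ?L")
        case False
        have "reflection_invariant f (?w (2 * ?L - (2 * ?L - \<mu>)))"
        proof (rule householder_S)
          show "reflection_invariant f (?w ?L)" using Suc.IH L by blast
          have "A \<le> 2 * ?L - \<mu>" "2 * ?L - \<mu> \<le> ?L" using \<mu> False by (auto simp: algebra_simps)
          then show "reflection_invariant f (?w (2 * ?L - \<mu>))" using Suc.IH by blast
        qed
        then show ?thesis by simp
      qed (use Suc \<mu> in blast)
    qed
  qed
  have ge: "reflection_invariant f (?w \<mu>)" if "A \<le> \<mu>" for \<mu>
  proof -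
    obtain n where "(\<mu> - A) / (B - A) < 2 ^ n"
      using real_arch_pow[of 2 "(\<mu> - A) / (B - A)"] by auto
    then have "\<mu> \<le> A + 2 ^ n * (B - A)" using \<open>A < B\<close> by (simp add: field_simps)
    then show ?thesis using double that by blast
  qed
  have all: "reflection_invariant f (?w \<mu>)" for \<mu>
  proof -
    obtain m :: nat where "(A - \<mu>) / (2 * pi) < of_nat m" using reals_Archimedean2 by blast
    then have "A \<le> \<mu> + 2 * real m * pi" by (simp add: field_simps)
    from ge[OF this] show ?thesis by (simp add: sin_add cos_add)
  qed
  obtain r a where "v = r * cos a" "- u = r * sin a" using polar_Ex by blast
  then have "upd2 i j 0 u v = r *\<^sub>R ?w a"
    by (auto simp: vec_eq_iff upd2_def)
  then show ?thesis using reflection_invariant_scaleR[OF all] by simp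
qed

text \<open>Permutations carry the \<open>(i, j)\<close>-plane to every coordinate plane. For
  general \<open>w\<close>, a reflection along a vector of a coordinate plane removes one nonzero
  coordinate, and induction on their number ends inside a coordinate plane.\<close>

lemma reflection_invariant_all:
  fixes f :: "real ^ 'n::finite \<Rightarrow> ennreal"
  assumes f: "schur2_concave f" and ij: "i \<noteq> j"
    and plane: "\<And>u v. reflection_invariant f (upd2 i j 0 u v)"
  shows "reflection_invariant f w"
proof -
  have planes: "reflection_invariant f (upd2 k l 0 u v)" if kl: "k \<noteq> l" for k l u v
  proof -
    \<comment> \<open>\<tau> sends \<open>k\<close> to \<open>i\<close>; the second transposition
      sends \<open>\<tau> l\<close> to \<open>j\<close> and fixes \<open>i\<close>, which differs
      from both.\<close>
    define \<tau> where "\<tau> = Transposition.transpose k i"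
    define \<pi> where "\<pi> = Transposition.transpose j (\<tau> l) \<circ> \<tau>"
    have \<pi>: "bij \<pi>" by (simp add: \<pi>_def \<tau>_def bij_comp)
    have "\<tau> k = i" "\<tau> l \<noteq> i" using kl by (auto simp: \<tau>_def Transposition.transpose_def)
    then have "\<pi> k = i" "\<pi> l = j" using ij by (auto simp: \<pi>_def Transposition.transpose_def)
    then have "\<pi> m = i \<longleftrightarrow> m = k" "\<pi> m = j \<longleftrightarrow> m = l" for m
      using \<pi> by (metis bij_pointE)+
    then have eq: "upd2 k l 0 u v = (\<chi> m. upd2 i j 0 u v $ \<pi> m)"
      by (simp add: vec_eq_iff upd2_def)
    have "AE y in lebesgue. f (\<chi> m. y $ \<pi> m) = f y"
      by (intro AE_I2 schur2_concave_permute[OF f \<pi>])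
    from reflection_invariant_orthogonal[OF orthogonal_transformation_permute[OF \<pi>] this plane]
    show ?thesis unfolding eq .
  qed
  show ?thesis
  proof (induction "card {l. w $ l \<noteq> 0}" arbitrary: w rule: less_induct)
    case less
    show ?case
    proof (cases "\<exists>k l. k \<noteq> l \<and> w $ k \<noteq> 0 \<and> w $ l \<noteq> 0")
      case True
      then obtain k l where kl: "k \<noteq> l" "w $ k \<noteq> 0" "w $ l \<noteq> 0" by blast
      \<comment> \<open>\<rho> is the length of the \<open>(k, l)\<close>-part of \<open>w\<close>.
        The vector \<open>v\<close> is \<open>w\<close> minus the vector of equal norm with
        \<open>(k, l)\<close>-part \<open>(\<rho>, 0)\<close>, so the reflection along
        \<open>v\<close> exchanges those two.\<close>
      define \<rho> where "\<rho> = sqrt ((w $ k)\<^sup>2 + (w $ l)\<^sup>2)"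
      have \<rho>2: "\<rho> * \<rho> = (w $ k)\<^sup>2 + (w $ l)\<^sup>2" by (simp add: \<rho>_def)
      define v where "v = upd2 k l 0 (w $ k - \<rho>) (w $ l)"
      have vv: "v \<bullet> v = 2 * (v \<bullet> w)"
        using kl \<rho>2 by (simp add: v_def inner_upd2_0 power2_eq_square algebra_simps)
      have "v \<noteq> 0" using kl by (auto simp: v_def vec_eq_iff upd2_def)
      then have "v \<bullet> v \<noteq> 0" by simp
      then have "householder v w = w - v" unfolding householder_def vv[symmetric] by simp
      then have rw: "householder v w = upd2 k l w \<rho> 0"
        by (auto simp: vec_eq_iff v_def upd2_def)
      have "{m. householder v w $ m \<noteq> 0} \<subset> {m. w $ m \<noteq> 0}"
        unfolding rw using kl by (auto simp: upd2_def)
      then have "card {m. householder v w $ m \<noteq> 0} < card {m. w $ m \<noteq> 0}"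
        by (intro psubset_card_mono) auto
      then have "reflection_invariant f (householder v w)" by (rule less.hyps)
      then have "reflection_invariant f (householder v (householder v w))"
        using planes[OF kl(1), of "w $ k - \<rho>" "w $ l"] unfolding v_def[symmetric]
        by (metis reflection_invariant_refl)
      then show ?thesis by simp
    next
      case False
      obtain k where k: "\<And>l. l \<noteq> k \<Longrightarrow> w $ l = 0" using False by metis
      obtain l where l: "l \<noteq> k" using ij by metis
      have "w = upd2 k l 0 (w $ k) 0"
        using k by (auto simp: vec_eq_iff upd2_def)
      then show ?thesis using planes[OF l[symmetric]] by metis
    qed
  qed
qed


subsection \<open>Spherical symmetry and strictness\<close>

text \<open>Joint measurability in direction and point, for exchanging the two almost-everywhere
  quantifiers.\<close>

lemma householder_measurable [measurable]:
  fixes M :: "'b measure" and g h :: "'b \<Rightarrow> 'a::euclidean_space"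
  assumes [measurable]: "g \<in> borel_measurable M" "h \<in> borel_measurable M"
  shows "(\<lambda>p. householder (g p) (h p)) \<in> borel_measurable M"
  unfolding householder_def by measurable

text \<open>With \<open>e = y / norm y\<close>, the reflection along \<open>w = norm z *\<^sub>R e - z\<close> maps \<open>y\<close> to \<open>(norm y / norm z) *\<^sub>R z\<close>, and
  \<open>z\<close> is recovered from \<open>w\<close> by a map that is differentiable off a hyperplane, so null sets of \<open>w\<close> give
  null sets of \<open>z\<close>.\<close>

lemma AE_radial_eq:
  fixes f :: "'a::euclidean_space \<Rightarrow> 'b"
  assumes y: "y \<noteq> 0" and ae: "AE w in lebesgue. f (householder w y) = f y"
  shows "AE z in lebesgue. f ((norm y / norm z) *\<^sub>R z) = f y"
proof -
  define e where "e = (1 / norm y) *\<^sub>R y"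
  have e: "norm e = 1" and y_e: "y = norm y *\<^sub>R e" using y by (simp_all add: e_def)
  have ee: "e \<bullet> e = 1" using e by (simp add: dot_square_norm)
  \<comment> \<open>For \<open>w = norm z *\<^sub>R e - z\<close> the quotient equals
    \<open>norm z\<close>, so that \<open>q w = z\<close>.\<close>
  define q where "q w = ((w \<bullet> w) / (2 * (e \<bullet> w))) *\<^sub>R e - w" for w
  define B where "B = {w. f (householder w y) \<noteq> f y}"
  have "B \<in> null_sets lebesgue"
    using ae unfolding completion.AE_iff_null_sets by (simp add: B_def)
  then have B: "negligible B" by (simp add: negligible_iff_null_sets)
  have "negligible (q ` (B \<inter> {w. e \<bullet> w \<noteq> 0}))"
  proof (rule negligible_differentiable_image_negligible)
    show "negligible (B \<inter> {w. e \<bullet> w \<noteq> 0})" using B by (rule negligible_subset) auto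
    show "q differentiable_on B \<inter> {w. e \<bullet> w \<noteq> 0}"
      unfolding q_def differentiable_on_def
      by (auto intro!: derivative_intros differentiable_divide differentiable_scaleR
          bounded_linear_imp_differentiable bounded_linear_inner_right differentiable_inner)
  qed simp
  then have null: "insert 0 (q ` (B \<inter> {w. e \<bullet> w \<noteq> 0})) \<in> null_sets lebesgue"
    by (simp add: negligible_iff_null_sets[symmetric] negligible_insert)
  show ?thesis
  proof (rule AE_I'[OF null], rule subsetI, rule ccontr)
    fix z assume "z \<in> {z \<in> space lebesgue. f ((norm y / norm z) *\<^sub>R z) \<noteq> f y}"
      and "z \<notin> insert 0 (q ` (B \<inter> {w. e \<bullet> w \<noteq> 0}))"
    then have bad: "f ((norm y / norm z) *\<^sub>R z) \<noteq> f y"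
      and z: "z \<noteq> 0" "z \<notin> q ` (B \<inter> {w. e \<bullet> w \<noteq> 0})" by auto
    define w where "w = norm z *\<^sub>R e - z"
    have zz: "z \<bullet> z = norm z * norm z" by (simp add: dot_square_norm power2_eq_square)
    have ew: "e \<bullet> w = norm z - e \<bullet> z" by (simp add: w_def inner_diff_right ee)
    have ww: "w \<bullet> w = 2 * norm z * (e \<bullet> w)"
      unfolding ew by (simp add: w_def inner_diff_right inner_diff_left ee zz inner_commute algebra_simps)
    \<comment> \<open>Otherwise \<open>z\<close> is a positive multiple of \<open>y\<close>, where
      the asserted equality is trivial.\<close>
    have "e \<bullet> w \<noteq> 0"
    proof
      assume "e \<bullet> w = 0"
      then have "w = 0" using ww by simp
      then have "z = norm z *\<^sub>R e" by (simp add: w_def)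
      then have "(norm y / norm z) *\<^sub>R z = (norm y / norm z) *\<^sub>R (norm z *\<^sub>R e)" by metis
      also have "\<dots> = y" using z y_e by simp
      finally show False using bad by simp
    qed
    have "q w = norm z *\<^sub>R e - w"
      using \<open>e \<bullet> w \<noteq> 0\<close> by (simp add: q_def ww)
    then have "q w = z" by (simp add: w_def)
    have "w \<bullet> y = norm y * (e \<bullet> w)"
      by (subst y_e) (simp add: inner_commute)
    then have "2 * (w \<bullet> y) / (w \<bullet> w) = norm y / norm z"
      using \<open>e \<bullet> w \<noteq> 0\<close> unfolding ww by simp
    then have "householder w y = y - (norm y / norm z) *\<^sub>R w" by (simp add: householder_def)
    also have "\<dots> = (norm y / norm z) *\<^sub>R z"
      using z y_e by (simp add: w_def scaleR_diff_right)
    finally have "w \<in> B" using bad by (simp add: B_def)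
    then show False using z \<open>q w = z\<close> \<open>e \<bullet> w \<noteq> 0\<close> by blast
  qed
qed

lemma reflection_invariant_imp_spherically_symmetric:
  fixes f :: "real ^ 'n::finite \<Rightarrow> ennreal"
  assumes f: "f \<in> borel_measurable lebesgue" and inv: "\<And>w. reflection_invariant f w"
  shows "\<exists>h. spherically_symmetric h \<and> lebesgue_equivalent f h"
proof -
  obtain f' where f' [measurable]: "f' \<in> borel_measurable lborel" and "AE x in lborel. f x = f' x"
    using completion_ex_borel_measurable[OF f] by blast
  then have ff': "AE x in lebesgue. f x = f' x" by (simp add: AE_completion_iff)
  have householder': "AE y in lborel. f' (householder w y) = f' y" for w
  proof -
    have "AE y in lebesgue. f' (householder w y) = f' y"
      using AE_orthogonal[OF orthogonal_transformation_refl ff', of w] ff' inv[of w]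
      unfolding reflection_invariant_def by eventually_elim simp
    then show ?thesis by (simp add: AE_completion_iff)
  qed
  have "(AE w in lborel. AE y in lborel. f' (householder w y) = f' y) \<longleftrightarrow>
      (AE y in lborel. AE w in lborel. f' (householder w y) = f' y)"
    by (rule lborel_pair.AE_commute) measurable
  then have AE2: "AE y in lborel. AE w in lborel. f' (householder w y) = f' y" using householder' by simp
  \<comment> \<open>Integrating over \<open>z\<close> in a cube of volume one averages over the
    directions of \<open>z\<close>. By \<open>AE_radial_eq\<close> the integrand is almost
    everywhere \<open>f' y\<close> for almost every \<open>y\<close>, while \<open>h y\<close>
    depends only on \<open>norm y\<close>.\<close>
  let ?C = "cbox 0 One :: (real ^ 'n) set"
  define h where "h y = (\<integral>\<^sup>+ z. f' ((norm y / norm z) *\<^sub>R z) * indicator ?C z \<partial>lborel)" for y :: "real ^ 'n"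
  have C1: "emeasure lborel ?C = 1" by (simp add: emeasure_lborel_cbox_eq inner_Basis)
  have [measurable]: "h \<in> borel_measurable lborel"
    unfolding h_def by measurable
  then have h: "h \<in> borel_measurable lebesgue" by (rule measurable_completion)
  have "AE y in lborel. y \<noteq> (0 :: real ^ 'n)" by (rule AE_lborel_singleton)
  with AE2 have "AE y in lborel. f' y = h y"
  proof eventually_elim
    case (elim y)
    then have "AE z in lborel. f' ((norm y / norm z) *\<^sub>R z) = f' y"
      using AE_radial_eq[of y f'] by (simp add: AE_completion_iff)
    then have "h y = (\<integral>\<^sup>+ z. f' y * indicator ?C z \<partial>lborel)"
      unfolding h_def by (intro nn_integral_cong_AE) auto
    also have "\<dots> = f' y" by (simp add: nn_integral_cmult C1)
    finally show ?case by simp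
  qed
  then have "AE y in lebesgue. f' y = h y" by (simp add: AE_completion_iff)
  with ff' have "AE y in lebesgue. f y = h y" by eventually_elim simp
  moreover have "spherically_symmetric h"
    using h by (auto simp: spherically_symmetric_def constant_on_def h_def)
  ultimately show ?thesis using f h by (auto simp: lebesgue_equivalent_def)
qed

text \<open>The arcsine is the polar angle of \<open>(sqrt u, sqrt v)\<close> on the circle of
  radius \<open>sqrt R\<close>; \<open>v \<le> u\<close> keeps it at or below
  \<open>pi / 4\<close>.\<close>

lemma sqrt_polar:
  fixes u v :: real
  assumes uv: "0 \<le> u" "0 \<le> v" "v \<le> u" and R: "u + v = R" "0 < R"
  shows "sqrt R * sin (arcsin (sqrt (v / R))) = sqrt v"
    and "sqrt R * cos (arcsin (sqrt (v / R))) = sqrt u"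
    and "0 \<le> arcsin (sqrt (v / R))" and "arcsin (sqrt (v / R)) \<le> pi / 4"
    and "0 \<le> sqrt (v / R)" and "sqrt (v / R) \<le> 1"
proof -
  have vR: "0 \<le> v / R" "v / R \<le> 1 / 2" using uv R by (auto simp: field_simps)
  then have "sqrt (v / R) \<le> sqrt (1 / 2)" by (intro real_sqrt_le_mono)
  then have le: "sqrt (v / R) \<le> 1 / sqrt 2" by (simp add: real_sqrt_divide)
  have "v / R \<le> 1" using vR by linarith
  then show b: "0 \<le> sqrt (v / R)" "sqrt (v / R) \<le> 1"
    using vR(1) by simp_all
  show "sqrt R * sin (arcsin (sqrt (v / R))) = sqrt v"
    using b R by (simp add: real_sqrt_divide)
  have "cos (arcsin (sqrt (v / R))) = sqrt (1 - v / R)"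
    using b vR(1) cos_arcsin[OF order.trans[OF _ b(1)] b(2)] by simp
  also have "1 - v / R = u / R" using R by (simp add: field_simps)
  finally show "sqrt R * cos (arcsin (sqrt (v / R))) = sqrt u"
    using R by (simp add: real_sqrt_divide)
  show "0 \<le> arcsin (sqrt (v / R))" using b by (intro arcsin_nonneg) auto
  have "arcsin (sqrt (v / R)) \<le> arcsin (1 / sqrt 2)"
    using le by (intro arcsin_le_arcsin order.trans[OF _ b(1)]) auto
  then show "arcsin (sqrt (v / R)) \<le> pi / 4" by (simp add: arcsin_one_over_sqrt_2)
qed

text \<open>A transfer preserves \<open>X $ i + X $ j\<close>, so the square roots move along a
  circle towards the diagonal and the arc lemmas apply.\<close>

lemma gauss_conv_transfer:
  fixes f :: "real ^ 'n::finite \<Rightarrow> ennreal"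
  assumes f: "schur2_concave f" and cs: "0 < c" "0 < s"
    and X: "X \<in> nonneg_orthant" and ij: "i \<noteq> j" and \<delta>: "0 < \<delta>" "X $ j + \<delta> \<le> X $ i - \<delta>"
  defines "G \<equiv> \<lambda>a. gauss_conv c s f (\<chi> l. sqrt (a $ l))"
  defines "Y \<equiv> upd2 i j X (X $ i - \<delta>) (X $ j + \<delta>)"
  shows "G X \<le> G Y"
    and "G X = G Y \<Longrightarrow> G Y \<noteq> \<infinity> \<Longrightarrow> \<exists>h. spherically_symmetric h \<and> lebesgue_equivalent f h"
proof -
  define R where "R = X $ i + X $ j"
  have X0: "0 \<le> X $ i" "0 \<le> X $ j" using X by (auto simp: nonneg_orthant_def)
  have R: "0 < R" "X $ i + X $ j = R" "(X $ i - \<delta>) + (X $ j + \<delta>) = R"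
    using X0 \<delta> by (auto simp: R_def)
  define t1 t2 where "t1 = arcsin (sqrt (X $ j / R))" and "t2 = arcsin (sqrt ((X $ j + \<delta>) / R))"
  let ?x = "\<chi> l. sqrt (X $ l)"
  have "X $ j \<le> X $ i" "0 \<le> X $ i - \<delta>" "0 \<le> X $ j + \<delta>" using X0 \<delta> by linarith+
  note p1 = sqrt_polar[OF X0 \<open>X $ j \<le> X $ i\<close> R(2,1), folded t1_def]
    and p2 = sqrt_polar[OF \<open>0 \<le> X $ i - \<delta>\<close> \<open>0 \<le> X $ j + \<delta>\<close> \<delta>(2) R(3,1), folded t2_def]
  have t12: "t1 < t2"
    unfolding t1_def t2_def
  proof (rule arcsin_less_arcsin)
    show "- 1 \<le> sqrt (X $ j / R)" using p1(5) by linarith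
    show "sqrt (X $ j / R) < sqrt ((X $ j + \<delta>) / R)"
      using R \<delta> by (simp add: divide_strict_right_mono)
  qed (rule p2(6))
  have G: "G X = gauss_conv c s f (upd2 i j ?x (sqrt R * cos t1) (sqrt R * sin t1))"
    "G Y = gauss_conv c s f (upd2 i j ?x (sqrt R * cos t2) (sqrt R * sin t2))"
    unfolding G_def Y_def p1(1,2) p2(1,2) by (auto intro!: arg_cong[where f="gauss_conv c s f"] simp: vec_eq_iff upd2_def)
  have r: "0 < sqrt R" using R by simp
  show "G X \<le> G Y"
    unfolding G using t12 by (intro gauss_conv_arc_mono[OF f ij cs r p1(3) _ p2(4)]) simp
  show "\<exists>h. spherically_symmetric h \<and> lebesgue_equivalent f h" if eq: "G X = G Y" "G Y \<noteq> \<infinity>"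
  proof (rule reflection_invariant_imp_spherically_symmetric)
    show "f \<in> borel_measurable lebesgue" using f by (simp add: schur2_concave_def)
    fix w :: "real ^ 'n"
    \<comment> \<open>The interval from \<open>A\<close> to \<open>B\<close> avoids
      \<open>t1\<close> and ends at the mean angle, as \<open>gauss_conv_arc_eq\<close>
      requires.\<close>
    define A B where "A = (3 * t1 + t2) / 4" and "B = (t1 + t2) / 2"
    have AB: "t1 < A" "A < B" using t12 by (auto simp: A_def B_def)
    have "reflection_invariant f (upd2 i j 0 (- sin \<mu>) (cos \<mu>))" if "A \<le> \<mu>" "\<mu> \<le> B" for \<mu>
      using that AB
      by (intro gauss_conv_arc_eq[OF f ij cs r p1(3) t12 p2(4) eq[unfolded G]]) (auto simp: B_def)
    then have "reflection_invariant f (upd2 i j 0 u v)" for u v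
      by (rule reflection_invariant_plane[OF ij AB(2)])
    then show "reflection_invariant f w" by (rule reflection_invariant_all[OF f ij])
  qed
qed

section \<open>The theorem for Gaussian convolutions\<close>

lemma gauss_conv_measurable:
  fixes f :: "'a::euclidean_space \<Rightarrow> ennreal"
  assumes "f \<in> borel_measurable lebesgue"
  shows "gauss_conv c s f \<in> borel_measurable lebesgue"
proof -
  obtain f' where f' [measurable]: "f' \<in> borel_measurable lborel" and "AE x in lborel. f x = f' x"
    using completion_ex_borel_measurable[OF assms] by blast
  then have "gauss_conv c s f x = (\<integral>\<^sup>+ y. f' y * ennreal (c * exp (- s * (norm (y - x))\<^sup>2)) \<partial>lborel)" for x
    unfolding gauss_conv_def gauss_kernel_def nn_integral_completion
    by (intro nn_integral_cong_AE) auto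
  then have "gauss_conv c s f = (\<lambda>x. \<integral>\<^sup>+ y. f' y * ennreal (c * exp (- s * (norm (y - x))\<^sup>2)) \<partial>lborel)"
    by (rule ext)
  also have "\<dots> \<in> borel_measurable lborel" by measurable
  finally show ?thesis by (rule measurable_completion)
qed

lemma ennreal_less_or_infinity_trans:
  fixes a b c :: ennreal
  assumes "a < b \<or> (a = \<infinity> \<and> b = \<infinity>)" "b < c \<or> (b = \<infinity> \<and> c = \<infinity>)"
  shows "a < c \<or> (a = \<infinity> \<and> c = \<infinity>)"
  using assms by (elim disjE conjE) (blast intro: less_trans, simp_all)

lemma gauss_conv_schur2_concave:
  fixes f :: "real ^ 'n::finite \<Rightarrow> ennreal"
  assumes f: "schur2_concave f" and cs: "0 < c" "0 < s"
  shows "schur2_concave (gauss_conv c s f)"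
    and "\<nexists>h. spherically_symmetric h \<and> lebesgue_equivalent f h \<Longrightarrow>
      strictly_schur2_concave (gauss_conv c s f)"
proof -
  let ?F = "gauss_conv c s f"
  \<comment> \<open>The Schur-concave witness: the convolution at the nonnegative square roots,
    which represents it because of its sign invariance.\<close>
  define G where "G = (\<lambda>a. ?F (\<chi> l. sqrt (a $ l)))"
  have meas: "?F \<in> borel_measurable lebesgue"
    using f by (intro gauss_conv_measurable) (simp add: schur2_concave_def)
  have FG: "?F x = G (\<chi> l. (x $ l)\<^sup>2)" for x
    unfolding G_def by (rule gauss_conv_abs[OF f]) simp
  have perm: "G (\<chi> l. a $ \<pi> l) = G a" if "bij \<pi>" for a \<pi>
    using gauss_conv_permute[OF f that, of c s "\<chi> l. sqrt (a $ l)"] by (simp add: G_def)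
  have le: "G a \<le> G b" if "strictly_majorizes a b" "a \<in> nonneg_orthant" "b \<in> nonneg_orthant" for a b
    using that
  proof (rule strictly_majorizes_induct[where L="\<lambda>a b. G a \<le> G b"])
    show "G x \<le> G (upd2 i j x (x $ i - \<delta>) (x $ j + \<delta>))"
      if "x \<in> nonneg_orthant" "i \<noteq> j" "0 < \<delta>" "x $ j + \<delta> \<le> x $ i - \<delta>" for x i j \<delta>
      unfolding G_def by (rule gauss_conv_transfer(1)[OF f cs that])
  qed (auto simp: perm)
  have "schur_concave_on nonneg_orthant G"
    unfolding schur_concave_on_def
  proof (intro ballI impI)
    fix a b :: "real ^ 'n"
    assume ab: "a \<in> nonneg_orthant" "b \<in> nonneg_orthant" "majorizes a b"
    show "G a \<le> G b"
    proof (cases "decreasing_rearr a = decreasing_rearr b")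
      case True
      then obtain \<pi> where "bij \<pi>" "b = (\<chi> l. a $ \<pi> l)" by (rule decreasing_rearr_eq_imp_permute)
      then show ?thesis by (simp add: perm)
    qed (use ab le in \<open>auto simp: strictly_majorizes_def\<close>)
  qed
  then show "schur2_concave ?F" using meas FG by (auto simp: schur2_concave_def)
  assume no: "\<nexists>h. spherically_symmetric h \<and> lebesgue_equivalent f h"
  \<comment> \<open>This relation is transitive, and at each transfer equality of the values is
    possible only if both are infinite.\<close>
  define L where "L a b \<longleftrightarrow> G a < G b \<or> (G a = \<infinity> \<and> G b = \<infinity>)" for a b
  have L_trans: "L x z" if "L x y" "L y z" for x y z
    using that unfolding L_def by (rule ennreal_less_or_infinity_trans)
  have L_step: "L x (upd2 i j x (x $ i - \<delta>) (x $ j + \<delta>))"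
    if "x \<in> nonneg_orthant" "i \<noteq> j" "0 < \<delta>" "x $ j + \<delta> \<le> x $ i - \<delta>" for x i j \<delta>
  proof (cases "G x = G (upd2 i j x (x $ i - \<delta>) (x $ j + \<delta>))")
    case True
    then have "G (upd2 i j x (x $ i - \<delta>) (x $ j + \<delta>)) = \<infinity>"
      using gauss_conv_transfer(2)[OF f cs that] no unfolding G_def by blast
    then show ?thesis using True unfolding L_def by simp
  next
    case False
    moreover have "G x \<le> G (upd2 i j x (x $ i - \<delta>) (x $ j + \<delta>))"
      unfolding G_def by (rule gauss_conv_transfer(1)[OF f cs that])
    ultimately show ?thesis unfolding L_def by (simp add: order.strict_iff_order)
  qed
  have L_perm: "L x y" if "bij \<pi>" "L (\<chi> l. x $ \<pi> l) y" for x y \<pi>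
    using that(2) unfolding L_def perm[OF that(1)] .
  have L: "L a b" if "a \<in> nonneg_orthant" "b \<in> nonneg_orthant" "strictly_majorizes a b" for a b
    by (rule strictly_majorizes_induct[where L=L, OF that(3,1,2)])
      (erule (1) L_trans, erule (3) L_step, erule (1) L_perm)
  have "strictly_schur_concave_on nonneg_orthant G"
    unfolding strictly_schur_concave_on_def L_def[symmetric] using L by blast
  then show "strictly_schur2_concave ?F" using meas FG by (auto simp: strictly_schur2_concave_def)
qed

text \<open>Two points of equal norm are exchanged by the reflection along their difference, which
  leaves \<open>h\<close> and hence its convolution invariant.\<close>

lemma gauss_conv_spherically_symmetric:
  fixes f :: "real ^ 'n::finite \<Rightarrow> ennreal"
  assumes h: "spherically_symmetric h" and fh: "lebesgue_equivalent f h"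
  shows "spherically_symmetric (gauss_conv c s f)"
  unfolding spherically_symmetric_def
proof (intro conjI allI impI)
  show "gauss_conv c s f \<in> borel_measurable lebesgue"
    using fh by (intro gauss_conv_measurable) (simp add: lebesgue_equivalent_def)
  have eq: "gauss_conv c s f = gauss_conv c s h"
    unfolding gauss_conv_def using fh
    by (intro ext nn_integral_cong_AE) (auto simp: lebesgue_equivalent_def)
  \<comment> \<open>Radius 0 lies outside the definition of \<open>spherically_symmetric\<close>;
    there both points are the origin.\<close>
  have h_norm: "h x = h y" if "norm x = norm y" for x y
  proof (cases "norm y = 0")
    case False
    then have "h constant_on sphere 0 (norm y)" using h by (simp add: spherically_symmetric_def)
    then show ?thesis using that by (auto simp: constant_on_def)
  qed (use that in auto)
  have F_norm: "gauss_conv c s h x = gauss_conv c s h y" if "norm x = norm y" for x y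
  proof -
    have "x \<bullet> x = y \<bullet> y" using that by (simp add: dot_square_norm)
    then have "2 * ((x - y) \<bullet> x) = (x - y) \<bullet> (x - y)"
      by (simp add: inner_diff_left inner_diff_right inner_commute)
    then have "householder (x - y) x = y" by (cases "x = y") (simp_all add: householder_def)
    moreover have "gauss_conv c s h (householder (x - y) x) = gauss_conv c s h x"
    proof (rule gauss_conv_orthogonal_invariant[OF orthogonal_transformation_refl])
      show "h \<in> borel_measurable lebesgue" using h by (simp add: spherically_symmetric_def)
      show "AE z in lebesgue. h (householder (x - y) z) = h z"
        by (intro AE_I2 h_norm orthogonal_transformation_norm orthogonal_transformation_refl)
    qed
    ultimately show ?thesis by simp
  qed
  fix r :: real assume "0 < r"
  obtain x0 :: "real ^ 'n" where "norm x0 = r" using vector_choose_size[of r] \<open>0 < r\<close> by auto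
  then show "gauss_conv c s f constant_on sphere 0 r"
    unfolding eq constant_on_def by (intro exI[of _ "gauss_conv c s h x0"]) (auto intro: F_norm)
qed

section \<open>Gaussian smoothing as a convolution integral\<close>

lemma multivariate_normal_density_standard_norm:
  "multivariate_normal_density 0 (mat 1) (z :: real ^ 'n::finite) =
     (1 / sqrt (2 * pi)) ^ CARD('n) * exp (- (norm z)\<^sup>2 / 2)"
proof -
  have "(norm z)\<^sup>2 = (\<Sum>i\<in>UNIV. (z $ i)\<^sup>2)"
    unfolding power2_norm_eq_inner by (simp add: inner_vec_def power2_eq_square)
  then have "exp (- (norm z)\<^sup>2 / 2) = (\<Prod>i\<in>UNIV. exp (- (z $ i)\<^sup>2 / 2))"
    by (simp add: exp_sum[symmetric] sum_negf sum_divide_distrib)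
  then show ?thesis
    by (simp only: multivariate_normal_density_standard std_normal_density_def prod.distrib prod_constant)
qed

text \<open>The substitution \<open>y = x + \<sigma> *\<^sub>R z\<close> turns the expectation into
  the convolution, with the Jacobian absorbed into the constant. As \<open>Z\<close> has a density,
  \<open>f\<close> may be replaced by a Borel representative.\<close>

lemma gaussian_smoothing_eq_gauss_conv:
  fixes f :: "real ^ 'n::finite \<Rightarrow> ennreal"
  assumes Z: "standard_normal_vector M Z" and f: "f \<in> borel_measurable lebesgue" and \<sigma>: "0 < \<sigma>"
  shows "gaussian_smoothing M Z \<sigma> f =
    gauss_conv ((1 / sqrt (2 * pi)) ^ CARD('n) / \<sigma> ^ CARD('n)) (1 / (2 * \<sigma>\<^sup>2)) f"
proof
  fix x :: "real ^ 'n"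
  define D where "D = (\<lambda>z :: real ^ 'n. ennreal (multivariate_normal_density 0 (mat 1) z))"
  define K where "K = (\<lambda>y. ennreal (gauss_kernel ((1 / sqrt (2 * pi)) ^ CARD('n) / \<sigma> ^ CARD('n)) (1 / (2 * \<sigma>\<^sup>2)) x y))"
  have Kb [measurable]: "K \<in> borel_measurable borel" unfolding K_def by measurable
  have dist: "distributed M lborel Z D"
    using Z by (simp add: standard_normal_vector_def D_def)
  then have Zm [measurable]: "Z \<in> M \<rightarrow>\<^sub>M lborel" and Dm [measurable]: "D \<in> borel_measurable lborel"
    and law: "distr M lborel Z = density lborel D"
    by (auto simp: distributed_def)
  obtain f' where f' [measurable]: "f' \<in> borel_measurable lborel" and ff': "AE y in lborel. f y = f' y"
    using completion_ex_borel_measurable[OF f] by blast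
  have aff: "lborel = density (distr lborel borel (\<lambda>z :: real ^ 'n. x + \<sigma> *\<^sub>R z)) (\<lambda>_. ennreal (\<sigma> ^ CARD('n)))"
    using lborel_affine[of \<sigma> x] \<sigma> by simp
  have ff'_aff: "AE z in lborel. f (x + \<sigma> *\<^sub>R z) = f' (x + \<sigma> *\<^sub>R z)"
  proof -
    have "AE y in density (distr lborel borel (\<lambda>z :: real ^ 'n. x + \<sigma> *\<^sub>R z)) (\<lambda>_. ennreal (\<sigma> ^ CARD('n))). f y = f' y"
      using ff' unfolding aff[symmetric] .
    then have "AE y in distr lborel borel (\<lambda>z :: real ^ 'n. x + \<sigma> *\<^sub>R z). f y = f' y"
      using \<sigma> by (simp add: AE_density)
    then show ?thesis by (rule AE_distrD[rotated]) simp
  qed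
  have "AE z in distr M lborel Z. f (x + \<sigma> *\<^sub>R z) = f' (x + \<sigma> *\<^sub>R z)"
    unfolding law using ff'_aff by (auto simp: AE_density elim: eventually_mono)
  then have "AE \<omega> in M. f (x + \<sigma> *\<^sub>R Z \<omega>) = f' (x + \<sigma> *\<^sub>R Z \<omega>)"
    by (rule AE_distrD[OF Zm])
  then have "gaussian_smoothing M Z \<sigma> f x = (\<integral>\<^sup>+ \<omega>. f' (x + \<sigma> *\<^sub>R Z \<omega>) \<partial>M)"
    unfolding gaussian_smoothing_def by (intro nn_integral_cong_AE) (auto simp: add.commute)
  also have "\<dots> = (\<integral>\<^sup>+ z. D z * f' (x + \<sigma> *\<^sub>R z) \<partial>lborel)"
    by (rule distributed_nn_integral[OF dist, symmetric]) measurable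
  also have "\<dots> = (\<integral>\<^sup>+ z. ennreal (\<sigma> ^ CARD('n)) * (f' (x + \<sigma> *\<^sub>R z) * K (x + \<sigma> *\<^sub>R z)) \<partial>lborel)"
  proof (rule nn_integral_cong)
    fix z :: "real ^ 'n"
    have "multivariate_normal_density 0 (mat 1) z = \<sigma> ^ CARD('n) * gauss_kernel ((1 / sqrt (2 * pi)) ^ CARD('n) / \<sigma> ^ CARD('n)) (1 / (2 * \<sigma>\<^sup>2)) x (x + \<sigma> *\<^sub>R z)"
      using \<sigma> by (simp add: multivariate_normal_density_standard_norm gauss_kernel_def power_mult_distrib)
    then have "D z = ennreal (\<sigma> ^ CARD('n)) * K (x + \<sigma> *\<^sub>R z)"
      using \<sigma> by (simp add: D_def K_def ennreal_mult')
    then show "D z * f' (x + \<sigma> *\<^sub>R z) = ennreal (\<sigma> ^ CARD('n)) * (f' (x + \<sigma> *\<^sub>R z) * K (x + \<sigma> *\<^sub>R z))"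
      by (simp add: mult_ac)
  qed
  also have "\<dots> = (\<integral>\<^sup>+ y. f' y * K y \<partial>lborel)"
    by (subst (2) aff) (simp add: nn_integral_density nn_integral_distr)
  also have "\<dots> = (\<integral>\<^sup>+ y. f y * K y \<partial>lborel)"
    using ff' by (intro nn_integral_cong_AE) auto
  finally show "gaussian_smoothing M Z \<sigma> f x =
      gauss_conv ((1 / sqrt (2 * pi)) ^ CARD('n) / \<sigma> ^ CARD('n)) (1 / (2 * \<sigma>\<^sup>2)) f x"
    by (simp add: gauss_conv_def nn_integral_completion K_def)
qed

theorem theorem2p3:
  fixes M :: "'w measure"
    and Z :: "'w \<Rightarrow> real ^ 'n::finite"
    and f :: "real ^ 'n \<Rightarrow> ennreal"
    and \<sigma> :: real
  assumes "prob_space M"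
    and "standard_normal_vector M Z"
    and "schur2_concave f"
    and "0 < \<sigma>"
  shows "schur2_concave (gaussian_smoothing M Z \<sigma> f) \<and>
    ((\<nexists>h. spherically_symmetric h \<and> lebesgue_equivalent f h) \<longrightarrow>
      strictly_schur2_concave (gaussian_smoothing M Z \<sigma> f)) \<and>
    ((\<exists>h. spherically_symmetric h \<and> lebesgue_equivalent f h) \<longrightarrow>
      spherically_symmetric (gaussian_smoothing M Z \<sigma> f))"
proof -
  define c where "c = (1 / sqrt (2 * pi)) ^ CARD('n) / \<sigma> ^ CARD('n)"
  define s where "s = 1 / (2 * \<sigma>\<^sup>2)"
  have cs: "0 < c" "0 < s" using assms(4) by (simp_all add: c_def s_def)
  have "gaussian_smoothing M Z \<sigma> f = gauss_conv c s f"
    unfolding c_def s_def using assms(2-4)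
    by (intro gaussian_smoothing_eq_gauss_conv) (simp_all add: schur2_concave_def)
  then show ?thesis
    using gauss_conv_schur2_concave[OF assms(3) cs] gauss_conv_spherically_symmetric[of _ f c s]
    by auto
qed

end
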